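(* Let $g:(0,1)\to\mathbb{R}_+$ satisfy $g(\varepsilon)=o\!\left(\varepsilon\log(1/\varepsilon)/\log\log(1/\varepsilon)\right)$ as $\varepsilon\to 0$. Then for every $K>0$ there is $\varepsilon_0>0$ such that for every $\varepsilon\in(0,\varepsilon_0)$ and all sufficiently large $n$ (depending on $\varepsilon$) the following holds. Consider any SQ algorithm, which may depend on $n$ and on $\varepsilon$, such that for every product distribution $q$ on $\{0,1\}^n$ and every distribution $p$ on $\{0,1\}^n$ with $d_{\mathrm{TV}}(p,q)=\varepsilon$, given $\mathrm{STAT}$ access to $p$ it outputs, with probability at least $2/3$, a distribution $\widehat q$ with $d_{\mathrm{TV}}(\widehat q,q)\le g(\varepsilon)$. Then the algorithm either makes at least $n^{K}$ Statistical Queries, or makes at least one query of tolerance at most $n^{-K}$. (That is, it needs $n^{\omega(1)}$ queries or a query of tolerance $n^{-\omega(1)}$.)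
   Context: A product distribution on $\{0,1\}^n$ is one whose coordinates are mutually independent. $d_{\mathrm{TV}}(p,q)=\frac12\|p-q\|_1$ is the total variation distance. A Statistical Query is a function $F:\{0,1\}^n\to[-1,1]$. For $\tau>0$, the oracle $\mathrm{STAT}(\tau)$ for a distribution $p$ responds to the query $F$ with some value $v$ such that $|v-\mathbb{E}_{X\sim p}[F(X)]|\le\tau$; $\tau$ is the tolerance of the query. An SQ algorithm is a (possibly randomized) algorithm that accesses $p$ only through adaptive calls to this oracle, and its guarantee must hold for every valid way the oracle may answer. *)

theory Defs
  imports "HOL-Probability.Probability" "HOL-Library.Landau_Symbols"
begin

definition cube :: "nat \<Rightarrow> bool list set" where
  "cube n = {x. length x = n}"

definition dist_on_cube :: "nat \<Rightarrow> bool list pmf \<Rightarrow> bool" where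
  "dist_on_cube n p \<longleftrightarrow> set_pmf p \<subseteq> cube n"

definition product_dist :: "nat \<Rightarrow> bool list pmf \<Rightarrow> bool" where
  "product_dist n q \<longleftrightarrow> dist_on_cube n q \<and>
     prob_space.indep_vars (measure_pmf q) (\<lambda>_. count_space UNIV) (\<lambda>i x. x ! i) {..<n}"

definition d_TV :: "'a pmf \<Rightarrow> 'a pmf \<Rightarrow> real" where
  "d_TV p q = 1 / 2 * (\<Sum>\<^sub>\<infinity>x. \<bar>pmf p x - pmf q x\<bar>)"

type_synonym query = "bool list \<Rightarrow> real"

definition stat_query :: "nat \<Rightarrow> query \<Rightarrow> bool" where
  "stat_query n F \<longleftrightarrow> (\<forall>x\<in>cube n. F x \<in> {-1..1})"

text \<open>The exchanges (query, tolerance, answer) made so far, oldest first.\<close>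
type_synonym transcript = "(query \<times> real \<times> real) list"

text \<open>An oracle may be adaptive: its answer may depend on all earlier exchanges.\<close>
type_synonym stat_oracle = "transcript \<Rightarrow> query \<Rightarrow> real \<Rightarrow> real"

definition valid_oracle :: "nat \<Rightarrow> bool list pmf \<Rightarrow> stat_oracle \<Rightarrow> bool" where
  "valid_oracle n p orc \<longleftrightarrow>
     (\<forall>h F \<tau>. stat_query n F \<longrightarrow> \<tau> > 0 \<longrightarrow> \<bar>orc h F \<tau> - measure_pmf.expectation p F\<bar> \<le> \<tau>)"

datatype sq_action = Query query real | Output "bool list pmf"

text \<open>A deterministic SQ algorithm chooses its next action from the exchanges made so far; it
  learns about the unknown distribution only through the answers, and it need not halt.\<close>
type_synonym det_sq_alg = "transcript \<Rightarrow> sq_action"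

definition wf_det_sq_alg :: "nat \<Rightarrow> det_sq_alg \<Rightarrow> bool" where
  "wf_det_sq_alg n A \<longleftrightarrow> (\<forall>h F \<tau>. A h = Query F \<tau> \<longrightarrow> stat_query n F \<and> \<tau> > 0)"

text \<open>The exchanges of the first \<open>t\<close> steps; constant from the moment the algorithm halts.\<close>
primrec run :: "det_sq_alg \<Rightarrow> stat_oracle \<Rightarrow> nat \<Rightarrow> transcript" where
  "run A orc 0 = []"
| "run A orc (Suc t) =
     (case A (run A orc t) of
        Query F \<tau> \<Rightarrow> run A orc t @ [(F, \<tau>, orc (run A orc t) F \<tau>)]
      | Output _ \<Rightarrow> run A orc t)"

definition outputs :: "det_sq_alg \<Rightarrow> stat_oracle \<Rightarrow> bool list pmf \<Rightarrow> bool" where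
  "outputs A orc r \<longleftrightarrow> (\<exists>t. A (run A orc t) = Output r)"

definition makes_queries_at_least :: "real \<Rightarrow> det_sq_alg \<Rightarrow> stat_oracle \<Rightarrow> bool" where
  "makes_queries_at_least N A orc \<longleftrightarrow> (\<exists>t. real (length (run A orc t)) \<ge> N)"

definition makes_query_of_tolerance_at_most :: "real \<Rightarrow> det_sq_alg \<Rightarrow> stat_oracle \<Rightarrow> bool" where
  "makes_query_of_tolerance_at_most \<tau>\<^sub>0 A orc \<longleftrightarrow>
     (\<exists>t F \<tau> v. (F, \<tau>, v) \<in> set (run A orc t) \<and> \<tau> \<le> \<tau>\<^sub>0)"

text \<open>A randomized SQ algorithm is a probability measure on deterministic ones (with respect to
  an arbitrary sigma-algebra): all random coins are drawn at the start and hidden from the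
  oracle, which sees only the queries. A deterministic algorithm is the case of a point mass.\<close>
definition sq_alg :: "nat \<Rightarrow> det_sq_alg measure \<Rightarrow> bool" where
  "sq_alg n M \<longleftrightarrow> prob_space M \<and> (\<forall>A\<in>space M. wf_det_sq_alg n A)"

text \<open>Nothing guarantees that the set of deterministic algorithms that succeed against a given
  oracle is measurable, so this is inner probability; for measurable \<open>P\<close> it says
  that the probability of \<open>P\<close> is at least \<open>c\<close>.\<close>
definition prob_at_least :: "'a measure \<Rightarrow> real \<Rightarrow> ('a \<Rightarrow> bool) \<Rightarrow> bool" where
  "prob_at_least M c P \<longleftrightarrow> (\<exists>E\<in>sets M. (\<forall>x\<in>E. P x) \<and> measure M E \<ge> c)"

definition admissible ::
    "nat \<Rightarrow> real \<Rightarrow> bool list pmf \<Rightarrow> bool list pmf \<Rightarrow> stat_oracle \<Rightarrow> bool" where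
  "admissible n \<epsilon> q p orc \<longleftrightarrow>
     product_dist n q \<and> dist_on_cube n p \<and> d_TV p q = \<epsilon> \<and> valid_oracle n p orc"

definition learns :: "nat \<Rightarrow> real \<Rightarrow> real \<Rightarrow> det_sq_alg measure \<Rightarrow> bool" where
  "learns n \<epsilon> \<delta> M \<longleftrightarrow>
     (\<forall>q p orc. admissible n \<epsilon> q p orc \<longrightarrow>
        prob_at_least M (2 / 3)
          (\<lambda>A. \<exists>r. outputs A orc r \<and> dist_on_cube n r \<and> d_TV r q \<le> \<delta>))"

text \<open>Query complexity and tolerance are worst-case: an event counts as happening if, for some
  admissible input and valid oracle, it is not almost surely avoided. Inputs outside
  the promise are not used.\<close>
definition can_happen ::
    "nat \<Rightarrow> real \<Rightarrow> det_sq_alg measure \<Rightarrow> (det_sq_alg \<Rightarrow> stat_oracle \<Rightarrow> bool) \<Rightarrow> bool" where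
  "can_happen n \<epsilon> M E \<longleftrightarrow>
     (\<exists>q p orc. admissible n \<epsilon> q p orc \<and> \<not> (AE A in M. \<not> E A orc))"

end

theory Submission
  imports Defs "HOL-Real_Asymp.Real_Asymp"
begin

text \<open>
  Fix a block size \<open>m\<close> depending only on \<open>\<epsilon>\<close> and \<open>K\<close>, and hide a block \<open>S\<close> of \<open>m\<close> coordinates.
  Outside \<open>S\<close> all coordinates are independent with mean \<open>a = 1 / m\<close>; the clean distribution \<open>q S\<close>
  uses mean \<open>b = (1 + \<delta>) / m\<close> inside \<open>S\<close>, so the number of ones in \<open>S\<close> is nearly Poisson. Such a
  variable exceeds \<open>ln (1 / \<epsilon>) / ln (ln (1 / \<epsilon>))\<close> with probability more than \<open>\<epsilon>\<close>, hence moving mass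
  \<open>\<epsilon>\<close> between \<open>k + 1\<close> equally spaced values up to that order suffices to make any \<open>k\<close> coordinates of
  the block independent with mean \<open>a\<close>, although
  \<open>\<delta>\<close> is of order \<open>\<epsilon> * ln (1 / \<epsilon>) / ln (ln (1 / \<epsilon>))\<close>. This gives the corrupted \<open>p S\<close>.

  Relative to the product distribution with all means \<open>a\<close>, the densities of \<open>p S\<close> and \<open>p T\<close>
  are exactly uncorrelated if \<open>S\<close> and \<open>T\<close> share at most \<open>k\<close> points. There are about \<open>n ^ (k + 1)\<close>
  such blocks, and by Bessel's inequality a query of tolerance \<open>\<tau>\<close> separates only \<open>O(1 / \<tau>\<^sup>2)\<close>
  of them from the reference distribution. All others are consistent with the same answers, while
  the distributions \<open>q S\<close> are pairwise far apart.
\<close>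

subsection \<open>Distributions on the cube\<close>

text \<open>Bit strings are replaced by the sets of their one-positions, so that the number of ones
  in a block \<open>S\<close> becomes \<open>card (X \<inter> S)\<close> and sums over the cube
  split along disjoint sets of coordinates.\<close>

definition enc :: "nat \<Rightarrow> nat set \<Rightarrow> bool list" where
  "enc n X = map (\<lambda>i. i \<in> X) [0..<n]"

lemma bij_betw_enc: "bij_betw (enc n) (Pow {..<n}) (cube n)"
proof (rule bij_betw_byWitness[where f' = "\<lambda>x. {i. i < n \<and> x ! i}"])
  show "\<forall>X\<in>Pow {..<n}. {i. i < n \<and> enc n X ! i} = X"
    by (auto simp: enc_def)
  show "\<forall>x\<in>cube n. enc n {i. i < n \<and> x ! i} = x"
    by (auto simp: enc_def cube_def intro!: nth_equalityI)
qed (auto simp: enc_def cube_def)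

lemma finite_cube: "finite (cube n)"
  using bij_betw_finite[OF bij_betw_enc] by simp

lemma sum_cube: "(\<Sum>x\<in>cube n. f x) = (\<Sum>X\<in>Pow {..<n}. f (enc n X))"
  using sum.reindex_bij_betw[OF bij_betw_enc, of f] by simp

lemma pmf_outside_cube: "dist_on_cube n p \<Longrightarrow> x \<notin> cube n \<Longrightarrow> pmf p x = 0"
  by (auto simp: dist_on_cube_def set_pmf_eq)

lemma d_TV_cube:
  assumes "dist_on_cube n p" "dist_on_cube n q"
  shows "d_TV p q = 1 / 2 * (\<Sum>x\<in>cube n. \<bar>pmf p x - pmf q x\<bar>)"
proof -
  have "(\<Sum>\<^sub>\<infinity>x. \<bar>pmf p x - pmf q x\<bar>) = (\<Sum>\<^sub>\<infinity>x\<in>cube n. \<bar>pmf p x - pmf q x\<bar>)"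
    by (rule infsum_cong_neutral) (auto simp: assms[THEN pmf_outside_cube])
  then show ?thesis
    by (simp add: d_TV_def finite_cube)
qed

lemma d_TV_triangle_cube:
  assumes "dist_on_cube n p" "dist_on_cube n q" "dist_on_cube n r"
  shows "d_TV p q \<le> d_TV r p + d_TV r q"
proof -
  have "(\<Sum>x\<in>cube n. \<bar>pmf p x - pmf q x\<bar>)
      \<le> (\<Sum>x\<in>cube n. \<bar>pmf r x - pmf p x\<bar> + \<bar>pmf r x - pmf q x\<bar>)"
    by (rule sum_mono) linarith
  then show ?thesis
    by (simp add: d_TV_cube[OF assms(1,2)] d_TV_cube[OF assms(3,1)] d_TV_cube[OF assms(3,2)]
        sum.distrib)
qed

lemma sum_pmf_cube: "dist_on_cube n p \<Longrightarrow> (\<Sum>x\<in>cube n. pmf p x) = 1"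
  by (simp add: dist_on_cube_def finite_cube sum_pmf_eq_1)

text \<open>The differences on \<open>E\<close> and on its complement cancel, so neither exceeds
  half of the total absolute difference.\<close>

lemma d_TV_ge_event:
  assumes pq: "dist_on_cube n p" "dist_on_cube n q" and E: "E \<subseteq> cube n"
  shows "(\<Sum>x\<in>E. pmf p x) - (\<Sum>x\<in>E. pmf q x) \<le> d_TV p q"
proof -
  let ?d = "\<lambda>x. pmf p x - pmf q x"
  have "(\<Sum>x\<in>cube n. \<phi> x) = (\<Sum>x\<in>E. \<phi> x) + (\<Sum>x\<in>cube n - E. \<phi> x)" for \<phi> :: "bool list \<Rightarrow> real"
    using sum.subset_diff[OF E finite_cube] by (simp add: add.commute)
  from this[of ?d] this[of "\<lambda>x. \<bar>?d x\<bar>"]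
  have 1: "(\<Sum>x\<in>E. ?d x) = - (\<Sum>x\<in>cube n - E. ?d x)"
    and 2: "(\<Sum>x\<in>cube n. \<bar>?d x\<bar>) = (\<Sum>x\<in>E. \<bar>?d x\<bar>) + (\<Sum>x\<in>cube n - E. \<bar>?d x\<bar>)"
    using pq[THEN sum_pmf_cube] by (simp_all add: sum_subtractf)
  have "(\<Sum>x\<in>E. ?d x) \<le> (\<Sum>x\<in>E. \<bar>?d x\<bar>)" "- (\<Sum>x\<in>cube n - E. ?d x) \<le> (\<Sum>x\<in>cube n - E. \<bar>?d x\<bar>)"
    by (auto intro!: sum_mono simp flip: sum_negf)
  with 1 2 show ?thesis
    by (simp add: d_TV_cube[OF pq] sum_subtractf)
qed

lemma expectation_cube:
  assumes "dist_on_cube n p"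
  shows "measure_pmf.expectation p F = (\<Sum>x\<in>cube n. pmf p x * F x)"
  using assms by (subst integral_measure_pmf[OF finite_cube[of n]]) (auto simp: dist_on_cube_def)

lemma ex_cube_pmf:
  assumes nonneg: "\<And>X. X \<subseteq> {..<n} \<Longrightarrow> 0 \<le> w X" and one: "(\<Sum>X\<in>Pow {..<n}. w X) = 1"
  shows "\<exists>p. dist_on_cube n p \<and> (\<forall>X\<subseteq>{..<n}. pmf p (enc n X) = w X)"
proof -
  define v where "v x = (if x \<in> cube n then w {i. i < n \<and> x ! i} else 0)" for x
  have v_enc: "v (enc n X) = w X" if "X \<subseteq> {..<n}" for X
  proof -
    have "{i. i < n \<and> enc n X ! i} = X" using that by (auto simp: enc_def)
    then show ?thesis by (simp add: v_def) (simp add: cube_def enc_def)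
  qed
  have v0: "0 \<le> v x" for x
    by (auto simp: v_def intro!: nonneg)
  have "(\<integral>\<^sup>+x. ennreal (v x) \<partial>count_space UNIV) = (\<Sum>x\<in>cube n. ennreal (v x))"
    by (rule nn_integral_count_space'[OF finite_cube]) (auto simp: v_def)
  also have "\<dots> = ennreal (\<Sum>X\<in>Pow {..<n}. v (enc n X))"
    by (simp add: sum_ennreal v0 sum_cube)
  also have "\<dots> = 1"
    by (simp add: v_enc one)
  finally have emb: "pmf (embed_pmf v) x = v x" for x
    by (intro pmf_embed_pmf v0)
  have "dist_on_cube n (embed_pmf v)"
    unfolding dist_on_cube_def by (auto simp: set_pmf_eq emb v_def split: if_splits)
  then show ?thesis
    using emb v_enc by auto
qed

text \<open>Independence is transported from \<open>Pi_pmf\<close> along the map from functions to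
  lists. The finite criterion for independence asks for a nonempty index set, hence
  \<open>n > 0\<close>.\<close>

lemma ex_product_pmf:
  assumes n: "n > 0" and \<beta>: "\<And>i. \<beta> i \<in> {0..1}"
  shows "\<exists>q. product_dist n q \<and>
    (\<forall>X\<subseteq>{..<n}. pmf q (enc n X) = (\<Prod>i<n. if i \<in> X then \<beta> i else 1 - \<beta> i))"
proof -
  define P where "P = Pi_pmf {..<n} False (\<lambda>i. bernoulli_pmf (\<beta> i))"
  define h where "h f = map f [0..<n]" for f :: "nat \<Rightarrow> bool"
  define q where "q = map_pmf h P"
  have on: "dist_on_cube n q"
    by (auto simp: dist_on_cube_def q_def h_def cube_def)
  have vim: "h -` ((\<lambda>x. x ! j) -` C) = (\<lambda>f. f j) -` C" if "j < n" for j C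
    using that by (simp add: h_def vimage_def)
  have vim': "h -` (\<Inter>j<n. (\<lambda>x. x ! j) -` C j) = (\<Inter>j<n. (\<lambda>f. f j) -` C j)" for C
    by (simp add: vimage_INT vim)
  have meas: "measure_pmf.prob q E = measure_pmf.prob P (h -` E)" for E
    by (simp add: q_def)
  have "measure_pmf.prob q (\<Inter>j\<in>{..<n}. (\<lambda>x. x ! j) -` C j \<inter> space (measure_pmf q)) =
      (\<Prod>j<n. measure_pmf.prob q ((\<lambda>x. x ! j) -` C j \<inter> space (measure_pmf q)))" for C
  proof -
    have "measure_pmf.prob q (\<Inter>j<n. (\<lambda>x. x ! j) -` C j) =
        measure_pmf.prob P (\<Inter>j<n. (\<lambda>f. f j) -` C j \<inter> space (measure_pmf P))"
      by (simp only: meas vim') simp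
    also have "\<dots> = (\<Prod>j<n. measure_pmf.prob P ((\<lambda>f. f j) -` C j \<inter> space (measure_pmf P)))"
      unfolding P_def
      by (rule prob_space.indep_varsD_finite[OF measure_pmf.prob_space_axioms indep_vars_Pi_pmf])
        (use n in auto)
    also have "\<dots> = (\<Prod>j<n. measure_pmf.prob q ((\<lambda>x. x ! j) -` C j))"
      by (simp add: meas vim)
    finally show ?thesis
      by simp
  qed
  then have "prob_space.indep_vars (measure_pmf q) (\<lambda>_. count_space UNIV) (\<lambda>i x. x ! i) {..<n}"
    using n by (subst prob_space.indep_vars_finite[where E = "\<lambda>_. UNIV" and M = "measure_pmf q"
        and M' = "\<lambda>_. count_space UNIV" and I = "{..<n}" and X = "\<lambda>i x. x ! i"])
      (auto simp: measure_pmf.prob_space_axioms Int_stable_def lessThan_empty_iff intro: sigma_sets.Basic)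
  moreover have "pmf q (enc n X) = (\<Prod>i<n. if i \<in> X then \<beta> i else 1 - \<beta> i)" if "X \<subseteq> {..<n}" for X
  proof -
    have "h -` {enc n X} = Pi {..<n} (\<lambda>i. {i \<in> X})"
      by (simp add: set_eq_iff h_def enc_def Pi_def Ball_def)
    then have "pmf q (enc n X) = (\<Prod>i<n. pmf (bernoulli_pmf (\<beta> i)) (i \<in> X))"
      by (simp add: q_def P_def pmf_map measure_Pi_pmf_Pi measure_pmf_single del: pmf_bernoulli_True pmf_bernoulli_False)
    then show ?thesis
      using \<beta> by (auto intro!: prod.cong)
  qed
  ultimately show ?thesis
    using on unfolding product_dist_def by blast
qed

subsection \<open>Indistinguishable inputs defeat Statistical Query algorithms\<close>

lemma run_halted:
  assumes "A (run A orc t) = Output r" "t \<le> t'"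
  shows "run A orc t' = run A orc t"
  using assms(2,1) by (induction t' rule: dec_induct) auto

lemma output_unique:
  assumes "A (run A orc t) = Output r" "A (run A orc t') = Output r'"
  shows "r = r'"
  using run_halted[of A orc t r t'] run_halted[of A orc t' r' t] assms
  by (cases "t \<le> t'") auto

lemma length_run:
  "(\<And>s. s < t \<Longrightarrow> \<exists>F \<tau>. A (run A orc s) = Query F \<tau>) \<Longrightarrow> length (run A orc t) = t"
proof (induction t)
  case (Suc t)
  then obtain F \<tau> where "A (run A orc t) = Query F \<tau>" by blast
  with Suc show ?case by simp
qed simp

text \<open>Integrate the number of events containing \<open>x\<close>: at least \<open>c\<close>
  per index, at most \<open>C\<close> pointwise. This turns a bound valid for each fixed outcome of
  the coins into one for randomized algorithms.\<close>

lemma measure_double_counting: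
  assumes "prob_space M" and fin: "finite I" and E: "\<And>i. i \<in> I \<Longrightarrow> E i \<in> sets M"
    and c: "\<And>i. i \<in> I \<Longrightarrow> c \<le> measure M (E i)"
    and C: "\<And>x. x \<in> space M \<Longrightarrow> real (card {i\<in>I. x \<in> E i}) \<le> C"
  shows "c * real (card I) \<le> C"
proof -
  interpret prob_space M by fact
  have "c * real (card I) \<le> (\<Sum>i\<in>I. measure M (E i))"
    using sum_bounded_below[of I c] c by (simp add: mult.commute)
  also have "\<dots> = (\<Sum>i\<in>I. \<integral>x. indicator (E i) x \<partial>M)"
    using E by (intro sum.cong refl) (simp add: emeasure_eq_measure)
  also have "\<dots> = (\<integral>x. (\<Sum>i\<in>I. indicator (E i) x) \<partial>M)"
    using E by (intro Bochner_Integration.integral_sum[symmetric])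
      (simp add: emeasure_eq_measure)
  also have "\<dots> \<le> (\<integral>x. C \<partial>M)"
  proof (rule integral_mono)
    show "integrable M (\<lambda>x. \<Sum>i\<in>I. indicator (E i) x :: real)"
      using E by (intro Bochner_Integration.integrable_sum) (simp add: emeasure_eq_measure)
    fix x assume "x \<in> space M"
    have "(\<Sum>i\<in>I. indicator (E i) x :: real) = real (card {i\<in>I. x \<in> E i})"
      using fin by (simp add: indicator_def sum.If_cases Int_def)
    with C[OF \<open>x \<in> space M\<close>] show "(\<Sum>i\<in>I. indicator (E i) x) \<le> C" by simp
  qed simp
  also have "\<dots> = C"
    by (simp add: prob_space)
  finally show ?thesis .
qed

text \<open>The adversary gives the reference value \<open>\<mu> F\<close> whenever validity for
  \<open>p\<close> allows it; an answer differs from it only if \<open>\<mu> F\<close> misses the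
  true expectation by more than the tolerance.\<close>

definition hiding_oracle :: "(query \<Rightarrow> real) \<Rightarrow> bool list pmf \<Rightarrow> stat_oracle" where
  "hiding_oracle \<mu> p h F \<tau> =
     (if \<bar>\<mu> F - measure_pmf.expectation p F\<bar> \<le> \<tau> then \<mu> F else measure_pmf.expectation p F)"

lemma valid_hiding_oracle: "valid_oracle n p (hiding_oracle \<mu> p)"
  by (auto simp: valid_oracle_def hiding_oracle_def)

definition well_behaved :: "real \<Rightarrow> real \<Rightarrow> det_sq_alg \<Rightarrow> stat_oracle \<Rightarrow> bool" where
  "well_behaved N \<tau>\<^sub>0 A orc \<longleftrightarrow> \<not> makes_queries_at_least N A orc \<and>
     \<not> makes_query_of_tolerance_at_most \<tau>\<^sub>0 A orc"

text \<open>All tolerances used exceed \<open>\<tau>\<^sub>0\<close>, so an error of at most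
  \<open>\<tau>\<^sub>0\<close> keeps the reference answer valid. The comparison run, answered by
  \<open>\<mu>\<close> alone, is the same for all \<open>p\<close>.\<close>

lemma run_hiding_oracle_eq:
  assumes wb: "well_behaved N \<tau>\<^sub>0 A (hiding_oracle \<mu> p)"
    and good: "\<And>s F \<tau>. s < T \<Longrightarrow> A (run A (\<lambda>_ F _. \<mu> F) s) = Query F \<tau> \<Longrightarrow>
      \<bar>\<mu> F - measure_pmf.expectation p F\<bar> \<le> \<tau>\<^sub>0"
    and "t \<le> T"
  shows "run A (hiding_oracle \<mu> p) t = run A (\<lambda>_ F _. \<mu> F) t"
  using \<open>t \<le> T\<close>
proof (induction t)
  case (Suc t)
  let ?h = "run A (hiding_oracle \<mu> p) t"
  have IH: "?h = run A (\<lambda>_ F _. \<mu> F) t" using Suc by simp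
  show ?case
  proof (cases "A ?h")
    case (Query F \<tau>)
    then have "(F, \<tau>, hiding_oracle \<mu> p ?h F \<tau>) \<in> set (run A (hiding_oracle \<mu> p) (Suc t))"
      by simp
    then have "\<tau> > \<tau>\<^sub>0"
      using wb unfolding well_behaved_def makes_query_of_tolerance_at_most_def not_le[symmetric]
      by blast
    moreover have "\<bar>\<mu> F - measure_pmf.expectation p F\<bar> \<le> \<tau>\<^sub>0"
      using good[of t F \<tau>] Query Suc.prems IH by simp
    ultimately have "hiding_oracle \<mu> p ?h F \<tau> = \<mu> F"
      by (simp add: hiding_oracle_def)
    then show ?thesis
      using Query IH by simp
  next
    case (Output r)
    then show ?thesis using IH by simp
  qed
qed simp

text \<open>Each step of the reference run makes at most one query, which rules out at most
  \<open>B\<close> indices. All remaining indices see the same run and hence the same output, which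
  by separation is close to only one \<open>q i\<close>.\<close>

lemma successes_of_det_alg:
  fixes p q :: "'i \<Rightarrow> bool list pmf"
  assumes wf: "wf_det_sq_alg n A" and fin: "finite I"
    and q: "\<And>i. i \<in> I \<Longrightarrow> dist_on_cube n (q i)"
    and sep: "\<And>i j. i \<in> I \<Longrightarrow> j \<in> I \<Longrightarrow> i \<noteq> j \<Longrightarrow> d_TV (q i) (q j) > 2 * \<delta>"
    and bad: "\<And>F. stat_query n F \<Longrightarrow>
      real (card {i\<in>I. \<bar>\<mu> F - measure_pmf.expectation (p i) F\<bar> > \<tau>\<^sub>0}) \<le> B"
    and N: "N \<ge> 0"
    and J: "\<And>i. i \<in> J \<Longrightarrow> i \<in> I \<and> well_behaved N \<tau>\<^sub>0 A (hiding_oracle \<mu> (p i)) \<and>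
      (\<exists>r. outputs A (hiding_oracle \<mu> (p i)) r \<and> dist_on_cube n r \<and> d_TV r (q i) \<le> \<delta>)"
  shows "real (card J) \<le> 1 + (N + 1) * B"
proof -
  \<comment> \<open>A run that has not halted within \<open>T\<close> steps has made
    \<open>T \<ge> N\<close> queries, which \<open>well_behaved\<close> forbids; so only the first
    \<open>T\<close> steps matter.\<close>
  define T where "T = nat \<lceil>N\<rceil>"
  define ref where "ref = run A (\<lambda>_ F _. \<mu> F)"
  define Bad where "Bad F = {i\<in>I. \<bar>\<mu> F - measure_pmf.expectation (p i) F\<bar> > \<tau>\<^sub>0}" for F
  define BadAt where "BadAt s = (case A (ref s) of Query F \<tau> \<Rightarrow> Bad F | Output r \<Rightarrow> {})" for s
  \<comment> \<open>The zero query is legal, so \<open>B\<close> bounds a cardinality. This covers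
    the steps at which the reference run has already halted.\<close>
  have B0: "0 \<le> B"
    using bad[of "\<lambda>_. 0"] by (auto simp: stat_query_def intro: order_trans[rotated])
  have finJ: "finite J"
    using J fin by (meson finite_subset subsetI)
  have BadAt: "real (card (BadAt s)) \<le> B" for s
    using wf bad B0 by (auto simp: BadAt_def Bad_def wf_det_sq_alg_def split: sq_action.split)
  have finBadAt: "finite (BadAt s)" for s
    using fin by (auto simp: BadAt_def Bad_def split: sq_action.split)
  have out: "\<exists>t r. A (ref t) = Output r \<and> dist_on_cube n r \<and> d_TV r (q i) \<le> \<delta>"
    if i: "i \<in> J" "i \<notin> (\<Union>s<T. BadAt s)" for i
  proof -
    let ?orc = "hiding_oracle \<mu> (p i)"
    have wb: "well_behaved N \<tau>\<^sub>0 A ?orc" and "i \<in> I"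
      using J[OF i(1)] by auto
    have good: "\<bar>\<mu> F - measure_pmf.expectation (p i) F\<bar> \<le> \<tau>\<^sub>0"
      if "s < T" "A (run A (\<lambda>_ F _. \<mu> F) s) = Query F \<tau>" for s F \<tau>
    proof -
      have "BadAt s = Bad F"
        using that by (simp add: BadAt_def ref_def)
      then show ?thesis
        using i \<open>s < T\<close> \<open>i \<in> I\<close> by (auto simp: Bad_def not_less)
    qed
    have eq: "run A ?orc t = ref t" if "t \<le> T" for t
      unfolding ref_def by (rule run_hiding_oracle_eq[OF wb good that])
    have "\<exists>t<T. \<forall>F \<tau>. A (run A ?orc t) \<noteq> Query F \<tau>"
    proof (rule ccontr)
      assume "\<not> ?thesis"
      then have "length (run A ?orc T) = T"
        by (intro length_run) blast
      then have "real (length (run A ?orc T)) \<ge> N"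
        using real_nat_ceiling_ge[of N] by (simp add: T_def)
      then show False
        using wb by (auto simp: well_behaved_def makes_queries_at_least_def)
    qed
    then obtain t r' where t: "t < T" "A (run A ?orc t) = Output r'"
      by (metis sq_action.exhaust)
    obtain r where r: "outputs A ?orc r" "dist_on_cube n r" "d_TV r (q i) \<le> \<delta>"
      using J[OF i(1)] by auto
    then have "r = r'"
      using output_unique t(2) by (metis outputs_def)
    then show ?thesis
      using r t eq[of t] by auto
  qed
  have "i = j" if i: "i \<in> J - (\<Union>s<T. BadAt s)" and j: "j \<in> J - (\<Union>s<T. BadAt s)" for i j
  proof (rule ccontr)
    assume "i \<noteq> j"
    obtain t r where r: "A (ref t) = Output r" "dist_on_cube n r" "d_TV r (q i) \<le> \<delta>"
      using out[of i] i by blast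
    obtain t' r' where r': "A (ref t') = Output r'" "d_TV r' (q j) \<le> \<delta>"
      using out[of j] j by blast
    have "r = r'"
      using output_unique r(1) r'(1) unfolding ref_def by blast
    then have "d_TV (q i) (q j) \<le> \<delta> + \<delta>"
      using d_TV_triangle_cube[of n "q i" "q j" r] q J i j r r' by force
    then show False
      using sep[of i j] J i j \<open>i \<noteq> j\<close> by force
  qed
  then have "card (J - (\<Union>s<T. BadAt s)) \<le> 1"
    using finJ by (auto simp: card_le_Suc0_iff_eq)
  moreover have "card J \<le> card (J - (\<Union>s<T. BadAt s)) + card (\<Union>s<T. BadAt s)"
    using finJ finBadAt by (intro order_trans[OF card_mono card_Un_le]) auto
  moreover have "real (card (\<Union>s<T. BadAt s)) \<le> (\<Sum>s<T. real (card (BadAt s)))"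
    using card_UN_le[of "{..<T}" BadAt] by (simp flip: of_nat_sum)
  moreover have "\<dots> \<le> real T * B"
    using sum_bounded_above[of "{..<T}" "\<lambda>s. real (card (BadAt s))" B] BadAt by simp
  moreover have "real T * B \<le> (N + 1) * B"
    using N of_int_ceiling_le_add_one[of N] B0 by (intro mult_right_mono) (simp_all add: T_def)
  ultimately show ?thesis by linarith
qed

text \<open>If neither event can happen, then for each \<open>i\<close> an event of probability at
  least 2/3 consists of algorithms that are well-behaved and succeed against the hiding oracle for
  \<open>i\<close>. Double counting against the successes of a single deterministic algorithm
  contradicts \<open>large\<close>.\<close>

lemma sq_lower_bound:
  fixes p q :: "'i \<Rightarrow> bool list pmf"
  assumes M: "sq_alg n M" "learns n \<epsilon> \<delta> M" and fin: "finite I"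
    and q: "\<And>i. i \<in> I \<Longrightarrow> product_dist n (q i)"
    and p: "\<And>i. i \<in> I \<Longrightarrow> dist_on_cube n (p i)"
    and pq: "\<And>i. i \<in> I \<Longrightarrow> d_TV (p i) (q i) = \<epsilon>"
    and sep: "\<And>i j. i \<in> I \<Longrightarrow> j \<in> I \<Longrightarrow> i \<noteq> j \<Longrightarrow> d_TV (q i) (q j) > 2 * \<delta>"
    and bad: "\<And>F. stat_query n F \<Longrightarrow>
      real (card {i\<in>I. \<bar>\<mu> F - measure_pmf.expectation (p i) F\<bar> > \<tau>\<^sub>0}) \<le> B"
    and N: "N \<ge> 0" and large: "1 + (N + 1) * B < 2 / 3 * real (card I)"
  shows "can_happen n \<epsilon> M (makes_queries_at_least N) \<or>
    can_happen n \<epsilon> M (makes_query_of_tolerance_at_most \<tau>\<^sub>0)"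
proof (rule ccontr)
  assume cannot: "\<not> ?thesis"
  interpret prob_space M
    using M by (simp add: sq_alg_def)
  define orc where "orc i = hiding_oracle \<mu> (p i)" for i
  define success where "success i A \<longleftrightarrow>
    (\<exists>r. outputs A (orc i) r \<and> dist_on_cube n r \<and> d_TV r (q i) \<le> \<delta>)" for i A
  have "\<exists>E\<in>sets M. 2 / 3 \<le> measure M E \<and> (\<forall>A\<in>E. well_behaved N \<tau>\<^sub>0 A (orc i) \<and> success i A)"
    if i: "i \<in> I" for i
  proof -
    have adm: "admissible n \<epsilon> (q i) (p i) (orc i)"
      using i q p pq by (simp add: admissible_def orc_def valid_hiding_oracle)
    then have "AE A in M. well_behaved N \<tau>\<^sub>0 A (orc i)"
      using cannot by (auto simp: can_happen_def well_behaved_def)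
    \<comment> \<open>Good behaviour is known only off a null set \<open>Z\<close>, success only on
      some measurable \<open>E\<close>; the set \<open>E - Z\<close> keeps the probability of
      \<open>E\<close>.\<close>
    then obtain Z where Z: "Z \<in> null_sets M" "{A\<in>space M. \<not> well_behaved N \<tau>\<^sub>0 A (orc i)} \<subseteq> Z"
      by (auto simp: eventually_ae_filter)
    obtain E where E: "E \<in> sets M" "\<forall>A\<in>E. success i A" "2 / 3 \<le> measure M E"
      using M(2) adm unfolding learns_def prob_at_least_def success_def by blast
    have "measure M (E - Z) = measure M E"
      using Z(1) E(1) by (simp add: measure_Diff_null_set)
    then show ?thesis
      using E Z sets.sets_into_space[OF E(1)] by (intro bexI[of _ "E - Z"]) auto
  qed
  then obtain E where E: "\<And>i. i \<in> I \<Longrightarrow> E i \<in> sets M" "\<And>i. i \<in> I \<Longrightarrow> 2 / 3 \<le> measure M (E i)"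
      "\<And>i A. i \<in> I \<Longrightarrow> A \<in> E i \<Longrightarrow> well_behaved N \<tau>\<^sub>0 A (orc i) \<and> success i A"
    by metis
  have "2 / 3 * real (card I) \<le> 1 + (N + 1) * B"
  proof (rule measure_double_counting[OF prob_space_axioms fin, of E])
    fix A assume "A \<in> space M"
    then have "wf_det_sq_alg n A"
      using M by (simp add: sq_alg_def)
    then show "real (card {i \<in> I. A \<in> E i}) \<le> 1 + (N + 1) * B"
      using E(3) q by (intro successes_of_det_alg[OF _ fin _ sep bad N])
        (auto simp: product_dist_def orc_def success_def)
  qed (use E in auto)
  with large show False by simp
qed

subsection \<open>Almost disjoint sets\<close>

text \<open>A maximal family of \<open>m\<close>-sets with pairwise intersections of size at most \<open>k\<close> is large:
  every \<open>m\<close>-set shares \<open>k + 1\<close> points with some member.\<close>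
lemma ex_almost_disjoint_family:
  assumes "finite V" "k < m" "m \<le> card V"
  shows "\<exists>\<F>. finite \<F> \<and> (\<forall>S\<in>\<F>. S \<subseteq> V \<and> card S = m) \<and>
    (\<forall>S\<in>\<F>. \<forall>T\<in>\<F>. S \<noteq> T \<longrightarrow> card (S \<inter> T) \<le> k) \<and>
    (card V choose Suc k) \<le> card \<F> * (m choose Suc k)\<^sup>2"
proof -
  define \<S> where "\<S> = {S. S \<subseteq> V \<and> card S = m}"
  have fin\<S>: "finite \<S>" using assms(1) by (simp add: \<S>_def)
  define P where "P \<F> \<longleftrightarrow> \<F> \<subseteq> \<S> \<and> (\<forall>S\<in>\<F>. \<forall>T\<in>\<F>. S \<noteq> T \<longrightarrow> card (S \<inter> T) \<le> k)" for \<F>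
  have "P {}" by (simp add: P_def)
  moreover have "\<forall>\<F>. P \<F> \<longrightarrow> card \<F> < Suc (card \<S>)"
    using fin\<S> by (auto simp: P_def less_Suc_eq_le intro: card_mono)
  ultimately obtain \<F> where \<F>: "P \<F>" and max: "\<And>\<G>. P \<G> \<Longrightarrow> card \<G> \<le> card \<F>"
    using ex_has_greatest_nat[of P "{}" card "Suc (card \<S>)"] by blast
  have members: "T \<subseteq> V \<and> card T = m" if "T \<in> \<F>" for T
    using that \<F> by (auto simp: P_def \<S>_def)
  have fin: "finite \<F>" using \<F> fin\<S> by (auto simp: P_def intro: finite_subset)
  \<comment> \<open>By maximality every \<open>m\<close>-set contains a subset \<open>U\<close> of
    size \<open>k + 1\<close> of some member \<open>T\<close>; the pairs \<open>(T, U)\<close> index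
    a cover of all \<open>m\<close>-sets.\<close>
  define R where "R = (SIGMA T:\<F>. {U. U \<subseteq> T \<and> card U = Suc k})"
  define ext where "ext U = {S\<in>\<S>. U \<subseteq> S}" for U
  have "\<S> \<subseteq> (\<Union>(T, U)\<in>R. ext U)"
  proof
    fix S assume S: "S \<in> \<S>"
    have "\<exists>T\<in>\<F>. k < card (S \<inter> T)"
    proof (rule ccontr)
      assume no: "\<not> ?thesis"
      \<comment> \<open>As a member, \<open>S\<close> would meet itself in \<open>m > k\<close>
        points; so it is new, and adding it contradicts maximality.\<close>
      then have "S \<notin> \<F>" using S assms(2) by (force simp: \<S>_def)
      moreover have "P (insert S \<F>)"
        using no \<F> S by (auto simp: P_def Int_commute not_less)
      ultimately show False
        using max[of "insert S \<F>"] fin by simp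
    qed
    then obtain T where T: "T \<in> \<F>" "Suc k \<le> card (S \<inter> T)"
      using Suc_leI by blast
    obtain U where U: "U \<subseteq> S \<inter> T" "card U = Suc k"
      by (rule obtain_subset_with_card_n[OF T(2)]) (rule that)
    show "S \<in> (\<Union>(T, U)\<in>R. ext U)"
    proof (rule UN_I[of "(T, U)"])
      show "(T, U) \<in> R" using T(1) U by (simp add: R_def)
      show "S \<in> (case (T, U) of (T, U) \<Rightarrow> ext U)" using S U by (simp add: ext_def)
    qed
  qed
  moreover have finR: "finite R"
    unfolding R_def
  proof (rule finite_SigmaI[OF fin])
    fix T assume "T \<in> \<F>"
    then have "{U. U \<subseteq> T \<and> card U = Suc k} \<subseteq> Pow V"
      using members by blast
    then show "finite {U. U \<subseteq> T \<and> card U = Suc k}"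
      using assms(1) by (auto intro: finite_subset)
  qed
  ultimately have "card \<S> \<le> card (\<Union>(T, U)\<in>R. ext U)"
    using fin\<S> by (intro card_mono) (auto simp: ext_def)
  also have "\<dots> \<le> (\<Sum>(T, U)\<in>R. card (ext U))"
    using card_UN_le[OF finR, of "\<lambda>(T, U). ext U"] by (simp add: case_prod_unfold)
  also have "\<dots> = (\<Sum>(T, U)\<in>R. (card V - Suc k) choose (m - Suc k))"
  proof (intro sum.cong refl, clarify)
    fix T U assume "(T, U) \<in> R"
    then have U: "U \<subseteq> V" "card U = Suc k" using members by (auto simp: R_def)
    then have finU: "finite U" using assms(1) finite_subset by blast
    have "bij_betw (\<lambda>W. W \<union> U) {W. W \<subseteq> V - U \<and> card W = m - Suc k} (ext U)"
    proof (rule bij_betw_byWitness[where f' = "\<lambda>S. S - U"])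
      show "(\<lambda>W. W \<union> U) ` {W. W \<subseteq> V - U \<and> card W = m - Suc k} \<subseteq> ext U"
      proof clarify
        fix W assume W: "W \<subseteq> V - U" "card W = m - Suc k"
        then have "card (W \<union> U) = card W + card U"
          using assms(1) finU by (intro card_Un_disjoint) (auto intro: finite_subset)
        then show "W \<union> U \<in> ext U"
          using W U assms(2) by (auto simp: ext_def \<S>_def)
      qed
      show "(\<lambda>S. S - U) ` ext U \<subseteq> {W. W \<subseteq> V - U \<and> card W = m - Suc k}"
        using U finU by (auto simp: ext_def \<S>_def card_Diff_subset)
    qed (auto simp: ext_def)
    then have "card (ext U) = card {W. W \<subseteq> V - U \<and> card W = m - Suc k}"
      by (simp add: bij_betw_same_card)
    also have "\<dots> = card (V - U) choose (m - Suc k)"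
      using assms(1) by (intro n_subsets) auto
    finally show "card (ext U) = (card V - Suc k) choose (m - Suc k)"
      using U finU by (simp add: card_Diff_subset)
  qed
  also have "\<dots> = card R * ((card V - Suc k) choose (m - Suc k))"
    by (simp add: case_prod_unfold)
  also have "card R = card \<F> * (m choose Suc k)"
  proof -
    have "card {U. U \<subseteq> T \<and> card U = Suc k} = m choose Suc k" if "T \<in> \<F>" for T
      using members[OF that] assms(1) by (subst n_subsets) (auto intro: finite_subset)
    then show ?thesis
      unfolding R_def using fin by (subst card_SigmaI) (auto intro!: card_ge_0_finite simp: assms(2) Suc_le_eq)
  qed
  finally have "(card V choose m) * (m choose Suc k)
      \<le> card \<F> * (m choose Suc k) * ((card V - Suc k) choose (m - Suc k)) * (m choose Suc k)"
    using n_subsets[OF assms(1), of m] by (simp add: \<S>_def)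
  \<comment> \<open>This identity costs the second factor \<open>m choose Suc k\<close> and makes
    the number of extensions of \<open>U\<close> cancel.\<close>
  moreover have "(card V choose m) * (m choose Suc k) = (card V choose Suc k) * ((card V - Suc k) choose (m - Suc k))"
    using assms by (intro choose_mult) auto
  ultimately have "((card V - Suc k) choose (m - Suc k)) * (card V choose Suc k)
      \<le> ((card V - Suc k) choose (m - Suc k)) * (card \<F> * (m choose Suc k)\<^sup>2)"
    by (simp only: power2_eq_square ac_simps)
  moreover have "0 < (card V - Suc k) choose (m - Suc k)"
    using assms by simp
  ultimately have "(card V choose Suc k) \<le> card \<F> * (m choose Suc k)\<^sup>2"
    using mult_le_cancel1 by blast
  then show ?thesis
    using fin \<F> by (intro exI[of _ \<F>]) (auto simp: P_def \<S>_def)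
qed

subsection \<open>Queries correlate with few members of an orthogonal family\<close>

text \<open>Expand the nonnegative norm of \<open>F - G / B\<close>, where \<open>G\<close> combines
  the \<open>H i\<close> with their correlations with \<open>F\<close> as coefficients. The
  \<open>H i\<close> are orthogonal but not normalised, hence the division by the norm bound
  \<open>B\<close>.\<close>

lemma bessel_inequality:
  fixes D F :: "'x \<Rightarrow> real" and H :: "'i \<Rightarrow> 'x \<Rightarrow> real"
  assumes fin: "finite I" and D: "\<And>x. x \<in> X \<Longrightarrow> 0 \<le> D x"
    and F: "(\<Sum>x\<in>X. D x * (F x)\<^sup>2) \<le> 1" and B: "B > 0"
    and norm: "\<And>i. i \<in> I \<Longrightarrow> (\<Sum>x\<in>X. D x * (H i x)\<^sup>2) \<le> B"
    and orth: "\<And>i j. i \<in> I \<Longrightarrow> j \<in> I \<Longrightarrow> i \<noteq> j \<Longrightarrow> (\<Sum>x\<in>X. D x * (H i x * H j x)) = 0"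
  shows "(\<Sum>i\<in>I. (\<Sum>x\<in>X. D x * (H i x * F x))\<^sup>2) \<le> B"
proof -
  define v where "v i = (\<Sum>x\<in>X. D x * (H i x * F x))" for i
  define G where "G x = (\<Sum>i\<in>I. v i * H i x)" for x
  define V where "V = (\<Sum>i\<in>I. (v i)\<^sup>2)"
  have FG: "(\<Sum>x\<in>X. D x * (F x * G x)) = V"
  proof -
    have "(\<Sum>x\<in>X. D x * (F x * G x)) = (\<Sum>i\<in>I. v i * (\<Sum>x\<in>X. D x * (H i x * F x)))"
      unfolding G_def sum_distrib_left by (subst sum.swap) (simp add: ac_simps)
    then show ?thesis by (simp add: V_def v_def power2_eq_square)
  qed
  have GG: "(\<Sum>x\<in>X. D x * (G x)\<^sup>2) \<le> B * V"
  proof -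
    have "(\<Sum>x\<in>X. D x * (G x)\<^sup>2) = (\<Sum>i\<in>I. \<Sum>j\<in>I. v i * v j * (\<Sum>x\<in>X. D x * (H i x * H j x)))"
    proof -
      have "(\<Sum>x\<in>X. D x * (G x)\<^sup>2) = (\<Sum>x\<in>X. \<Sum>i\<in>I. \<Sum>j\<in>I. v i * v j * (D x * (H i x * H j x)))"
        by (simp add: G_def power2_eq_square sum_product sum_distrib_left ac_simps)
      also have "\<dots> = (\<Sum>i\<in>I. \<Sum>j\<in>I. \<Sum>x\<in>X. v i * v j * (D x * (H i x * H j x)))"
        by (subst sum.swap, intro sum.cong refl, subst sum.swap) simp
      finally show ?thesis by (simp add: sum_distrib_left)
    qed
    also have "\<dots> = (\<Sum>i\<in>I. \<Sum>j\<in>I. if i = j then (v i)\<^sup>2 * (\<Sum>x\<in>X. D x * (H i x)\<^sup>2) else 0)"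
      by (intro sum.cong refl) (auto simp: orth power2_eq_square)
    also have "\<dots> = (\<Sum>i\<in>I. (v i)\<^sup>2 * (\<Sum>x\<in>X. D x * (H i x)\<^sup>2))"
      using fin by simp
    also have "\<dots> \<le> (\<Sum>i\<in>I. (v i)\<^sup>2 * B)"
      using norm by (intro sum_mono mult_left_mono) auto
    finally show ?thesis by (simp add: V_def sum_distrib_left mult.commute)
  qed
  have "0 \<le> (\<Sum>x\<in>X. D x * (F x - G x / B)\<^sup>2)"
    using D by (intro sum_nonneg) auto
  also have "\<dots> = (\<Sum>x\<in>X. D x * (F x)\<^sup>2) - 2 / B * (\<Sum>x\<in>X. D x * (F x * G x))
      + (\<Sum>x\<in>X. D x * (G x)\<^sup>2) / B\<^sup>2"
    unfolding sum_distrib_left sum_divide_distrib sum_subtractf[symmetric] sum.distrib[symmetric]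
    by (intro sum.cong refl) (simp add: power2_diff power_divide algebra_simps)
  also have "\<dots> \<le> 1 - 2 / B * V + B * V / B\<^sup>2"
    unfolding FG using F GG by (intro add_mono diff_mono divide_right_mono) auto
  also have "\<dots> = 1 - V / B"
    using B by (simp add: power2_eq_square)
  finally show ?thesis
    using B by (simp add: V_def v_def divide_le_eq)
qed

text \<open>Markov's inequality for the squared coefficients.\<close>

lemma card_large_coefficients:
  fixes v :: "'i \<Rightarrow> real"
  assumes "finite I" "\<tau> > 0" "(\<Sum>i\<in>I. (v i)\<^sup>2) \<le> B"
  shows "real (card {i\<in>I. \<bar>v i\<bar> > \<tau>}) \<le> B / \<tau>\<^sup>2"
proof -
  have "real (card {i\<in>I. \<bar>v i\<bar> > \<tau>}) * \<tau>\<^sup>2 \<le> (\<Sum>i\<in>{i\<in>I. \<bar>v i\<bar> > \<tau>}. (v i)\<^sup>2)"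
    using assms(2) by (intro sum_bounded_below) (auto simp: abs_le_square_iff[symmetric])
  also have "\<dots> \<le> (\<Sum>i\<in>I. (v i)\<^sup>2)"
    using assms(1) by (intro sum_mono2) auto
  finally show ?thesis
    using assms by (simp add: le_divide_eq)
qed

subsection \<open>Signed weights on a progression with prescribed binomial moments\<close>

text \<open>The coefficients in \<open>(x / s) gchoose t = (\<Sum>r\<le>t. gchoose_coeff s t r * (x choose r))\<close>; the recursion
  comes from \<open>x * (x choose r) = r * (x choose r) + (r + 1) * (x choose (r + 1))\<close>.\<close>
fun gchoose_coeff :: "real \<Rightarrow> nat \<Rightarrow> nat \<Rightarrow> real" where
  "gchoose_coeff s 0 r = (if r = 0 then 1 else 0)"
| "gchoose_coeff s (Suc t) r = ((r / s - t) * gchoose_coeff s t r + (if r = 0 then 0 else r / s * gchoose_coeff s t (r - 1))) / (t + 1)"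

lemma gchoose_coeff_upper: "t < r \<Longrightarrow> gchoose_coeff s t r = 0"
  by (induction t arbitrary: r) auto

lemma gchoose_coeff_diag: "s > 0 \<Longrightarrow> gchoose_coeff s t t \<noteq> 0"
  by (induction t) (auto simp: gchoose_coeff_upper add_eq_0_iff)

lemma mult_choose: "real x * real (x choose r) = r * real (x choose r) + (r + 1) * real (x choose Suc r)"
proof (cases "r \<le> x")
  case True
  have "Suc r * (x choose Suc r) = (x - r) * (x choose r)"
    using binomial_absorb_comp[of x r] binomial_absorption[of r x]
    by (cases x) (auto simp: algebra_simps Suc_diff_le)
  then have "(r + 1) * real (x choose Suc r) = (real x - r) * real (x choose r)"
    using True by (metis Suc_eq_plus1 of_nat_diff of_nat_mult)
  then show ?thesis by (simp add: algebra_simps)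
qed (simp add: not_le binomial_eq_0)

lemma gbinomial_gchoose_coeff:
  assumes "s > 0"
  shows "(real x / s) gchoose t = (\<Sum>r\<le>t. gchoose_coeff s t r * real (x choose r))"
proof (induction t)
  case (Suc t)
  let ?c = "\<lambda>r. real (x choose r)"
  have "(t + 1) * ((real x / s) gchoose Suc t) = (real x / s - t) * ((real x / s) gchoose t)"
    using gbinomial_mult_1[of "real x / s" t] by (simp add: algebra_simps)
  also have "\<dots> = (\<Sum>r\<le>t. gchoose_coeff s t r * ((real x * ?c r) / s - t * ?c r))"
    unfolding Suc by (simp add: sum_distrib_left algebra_simps)
  also have "\<dots> = (\<Sum>r\<le>t. (r / s - t) * gchoose_coeff s t r * ?c r + (r + 1) / s * gchoose_coeff s t r * ?c (Suc r))"
    by (simp add: mult_choose add_divide_distrib algebra_simps)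
  also have "\<dots> = (\<Sum>r\<le>Suc t. (r / s - t) * gchoose_coeff s t r * ?c r) + (\<Sum>r\<le>t. (r + 1) / s * gchoose_coeff s t r * ?c (Suc r))"
    by (simp add: sum.distrib gchoose_coeff_upper)
  also have "(\<Sum>r\<le>t. (r + 1) / s * gchoose_coeff s t r * ?c (Suc r)) =
      (\<Sum>r\<le>Suc t. (if r = 0 then 0 else r / s * gchoose_coeff s t (r - 1)) * ?c r)"
    by (subst sum.atMost_Suc_shift) (simp add: add.commute)
  also have "(\<Sum>r\<le>Suc t. (r / s - t) * gchoose_coeff s t r * ?c r) + \<dots> = (t + 1) * (\<Sum>r\<le>Suc t. gchoose_coeff s (Suc t) r * ?c r)"
    unfolding sum_distrib_left sum.distrib[symmetric] by (intro sum.cong refl) (simp add: field_simps)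
  finally show ?case
    by (simp del: gchoose_coeff.simps)
qed simp

text \<open>The factor \<open>1 / s\<close>, essential for the size of \<open>\<delta>\<close>, reflects that polynomials in \<open>x / s\<close>
  have small differences.\<close>
lemma gchoose_coeff_bound:
  assumes "s \<ge> 1" "t > 0" "t \<le> k" "r \<le> k"
  shows "\<bar>gchoose_coeff s t r\<bar> \<le> (3 * real k) ^ t / s"
  using assms(2-)
proof (induction t arbitrary: r)
  case (Suc t)
  show ?case
  proof (cases "t = 0")
    case True
    \<comment> \<open>In degree one the only nonzero coefficient is \<open>1 / s\<close>. Each later
      degree costs a factor of at most \<open>3 * k\<close>: \<open>2 * k\<close> from
      \<open>r / s - t\<close> and \<open>k\<close> from the shifted term.\<close>
    have "\<bar>gchoose_coeff s 1 r\<bar> \<le> 1 / s"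
      using assms(1) by (cases "r \<le> 1") (auto simp: gchoose_coeff_upper le_Suc_eq)
    also have "\<dots> \<le> (3 * real k) ^ 1 / s"
      using assms(1) Suc.prems by (intro divide_right_mono) auto
    finally show ?thesis using True by simp
  next
    case False
    let ?K = "(3 * real k) ^ t / s"
    have K: "0 \<le> ?K" using assms(1) by simp
    have "\<bar>gchoose_coeff s (Suc t) r\<bar> \<le> \<bar>(r / s - t) * gchoose_coeff s t r + (if r = 0 then 0 else r / s * gchoose_coeff s t (r - 1))\<bar>"
      by (simp add: divide_le_eq mult_le_cancel_left1 abs_mult) 
    also have "\<dots> \<le> \<bar>r / s - t\<bar> * \<bar>gchoose_coeff s t r\<bar> + (if r = 0 then 0 else r / s * \<bar>gchoose_coeff s t (r - 1)\<bar>)"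
      using assms(1) by (auto intro: order_trans[OF abs_triangle_ineq] simp: abs_mult)
    also have "\<dots> \<le> (2 * k) * ?K + k * ?K"
    proof (rule add_mono)
      have "r / s \<le> r" using assms(1) by (simp add: divide_le_eq mult_le_cancel_left1)
      then have rs: "r / s \<le> k" "0 \<le> r / s" using Suc.prems assms(1) by auto
      then have "\<bar>r / s - t\<bar> \<le> 2 * k" using Suc.prems by linarith
      then show "\<bar>r / s - t\<bar> * \<bar>gchoose_coeff s t r\<bar> \<le> (2 * k) * ?K"
        using Suc False by (intro mult_mono) auto
      show "(if r = 0 then 0 else r / s * \<bar>gchoose_coeff s t (r - 1)\<bar>) \<le> k * ?K"
      proof (cases "r = 0")
        case False
        then have "r / s * \<bar>gchoose_coeff s t (r - 1)\<bar> \<le> k * ?K"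
          using Suc.IH[of "r - 1"] Suc.prems \<open>t \<noteq> 0\<close> rs by (intro mult_mono) auto
        with False show ?thesis by simp
      next
        case True
        have "0 \<le> k * ?K" using K by (intro mult_nonneg_nonneg) simp_all
        with True show ?thesis by (simp only: if_True simp_thms)
      qed
    qed
    also have "\<dots> = (3 * real k) ^ Suc t / s"
      by (simp add: field_simps)
    finally show ?thesis .
  qed
qed simp

text \<open>Binomial inversion. Pulling out the factor \<open>u choose t\<close> leaves an
  alternating row sum of binomial coefficients, which vanishes unless \<open>u = t\<close>.\<close>

lemma choose_orthogonality:
  assumes "u \<le> k" "t \<le> k"
  shows "(\<Sum>i\<le>k. real (i choose t) * ((-1) ^ (u + i) * real (u choose i))) = (if u = t then 1 else 0)"
proof (cases "t \<le> u")
  case True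
  have "(\<Sum>i\<le>k. real (i choose t) * ((-1) ^ (u + i) * real (u choose i))) =
      (\<Sum>i\<in>{t..u}. real (i choose t) * ((-1) ^ (u + i) * real (u choose i)))"
    by (rule sum.mono_neutral_right) (use assms in auto)
  also have "\<dots> = (\<Sum>i\<in>{t..u}. real (u choose t) * ((-1) ^ (u + i) * real ((u - t) choose (i - t))))"
  proof (rule sum.cong)
    fix i assume "i \<in> {t..u}"
    then have "real (u choose i) * real (i choose t) = real (u choose t) * real ((u - t) choose (i - t))"
      using choose_mult[of t i u] by (simp flip: of_nat_mult)
    then show "real (i choose t) * ((-1) ^ (u + i) * real (u choose i)) =
        real (u choose t) * ((-1) ^ (u + i) * real ((u - t) choose (i - t)))"
      by (simp add: ac_simps)
  qed simp
  also have "\<dots> = (\<Sum>j\<le>u - t. real (u choose t) * ((-1) ^ (u + (j + t)) * real ((u - t) choose j)))"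
    using True by (intro sum.reindex_bij_witness[of _ "\<lambda>j. j + t" "\<lambda>i. i - t"]) auto
  also have "\<dots> = real (u choose t) * (-1) ^ (u + t) * (\<Sum>j\<le>u - t. (-1) ^ j * real ((u - t) choose j))"
    by (simp add: sum_distrib_left power_add ac_simps)
  also have "\<dots> = (if u = t then 1 else 0)"
    using choose_alternating_sum[of "u - t", where 'a = real] True by auto
  finally show ?thesis .
next
  case False
  then show ?thesis
    by (intro trans[OF sum.neutral]) (auto simp: not_le)
qed

text \<open>Interpolation at \<open>0, s, ..., k * s\<close>: the weights extract the coefficient of
  \<open>x choose r\<close> from a polynomial of degree at most \<open>k\<close>. The size bound
  leaves out \<open>r = 0\<close> because constants do not shrink under rescaling.\<close>

lemma ex_dual_weights:
  "\<exists>C>0. \<forall>s\<ge>1. \<exists>\<nu> :: nat \<Rightarrow> nat \<Rightarrow> real.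
     (\<forall>r\<le>k. \<forall>t\<le>k. (\<Sum>i\<le>k. \<nu> i r * real ((i * s) choose t)) = (if r = t then 1 else 0)) \<and>
     (\<forall>i\<le>k. \<forall>r\<in>{1..k}. \<bar>\<nu> i r\<bar> \<le> C / real s)"
proof -
  define C where "C = 1 + (\<Sum>u\<le>k. 2 ^ u * (3 * real k) ^ u)"
  have "\<exists>\<nu> :: nat \<Rightarrow> nat \<Rightarrow> real.
     (\<forall>r\<le>k. \<forall>t\<le>k. (\<Sum>i\<le>k. \<nu> i r * real ((i * s) choose t)) = (if r = t then 1 else 0)) \<and>
     (\<forall>i\<le>k. \<forall>r\<in>{1..k}. \<bar>\<nu> i r\<bar> \<le> C / real s)" if s: "s \<ge> 1" for s :: nat
  proof -
    \<comment> \<open>Finite differences at \<open>0\<close> in the variable \<open>x / s\<close>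
      read off coefficients in the basis \<open>(x / s) gchoose u\<close>;
      \<open>gchoose_coeff\<close> converts them to the basis \<open>x choose r\<close>.\<close>
    define \<nu>' where "\<nu>' i r = (\<Sum>u\<le>k. (-1) ^ (u + i) * real (u choose i) * gchoose_coeff s u r)" for i r
    define W where "W t r = (\<Sum>i\<le>k. \<nu>' i r * real ((i * s) choose t))" for t r
    have V: "(\<Sum>i\<le>k. real (i choose t) * \<nu>' i r) = gchoose_coeff s t r" if "t \<le> k" for t r
    proof -
      have "(\<Sum>i\<le>k. real (i choose t) * \<nu>' i r) =
          (\<Sum>u\<le>k. (\<Sum>i\<le>k. real (i choose t) * ((-1) ^ (u + i) * real (u choose i))) * gchoose_coeff s u r)"
        unfolding \<nu>'_def sum_distrib_left sum_distrib_right by (subst sum.swap) (simp add: ac_simps)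
      also have "\<dots> = (\<Sum>u\<le>k. if u = t then gchoose_coeff s u r else 0)"
        using that by (intro sum.cong refl) (simp add: choose_orthogonality)
      finally show ?thesis using that by simp
    qed
    have KW: "(\<Sum>v\<le>t. gchoose_coeff s t v * W v r) = gchoose_coeff s t r" if "t \<le> k" for t r
    proof -
      have "real (i choose t) = (\<Sum>v\<le>t. gchoose_coeff s t v * real ((i * s) choose v))" for i
        using gbinomial_gchoose_coeff[of s "i * s" t] s by (simp add: binomial_gbinomial)
      then have "gchoose_coeff s t r = (\<Sum>i\<le>k. (\<Sum>v\<le>t. gchoose_coeff s t v * real ((i * s) choose v)) * \<nu>' i r)"
        using V[OF that, of r] by simp
      also have "\<dots> = (\<Sum>v\<le>t. gchoose_coeff s t v * W v r)"
        unfolding W_def sum_distrib_left sum_distrib_right by (subst sum.swap) (simp add: ac_simps)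
      finally show ?thesis by simp
    qed
    \<comment> \<open>By \<open>KW\<close>, both \<open>W\<close> and the identity matrix solve one
      triangular system with nonzero diagonal; forward substitution in \<open>t\<close> shows that
      they agree.\<close>
    have W: "W t r = (if r = t then 1 else 0)" if "r \<le> k" "t \<le> k" for r t
      using that(2)
    proof (induction t rule: less_induct)
      case (less t)
      have "gchoose_coeff s t r = (\<Sum>v<t. gchoose_coeff s t v * W v r) + gchoose_coeff s t t * W t r"
        using KW[OF less.prems, of r] by (simp add: lessThan_Suc_atMost[symmetric])
      also have "(\<Sum>v<t. gchoose_coeff s t v * W v r) = (\<Sum>v<t. if v = r then gchoose_coeff s t r else 0)"
        using less by (intro sum.cong refl) auto
      also have "\<dots> = (if r < t then gchoose_coeff s t r else 0)"
        by simp
      finally have "gchoose_coeff s t t * W t r = (if r < t then 0 else gchoose_coeff s t r)"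
        by (auto split: if_splits)
      then show ?case
        using gchoose_coeff_diag[of s t] s gchoose_coeff_upper[of t r s] by (cases r t rule: linorder_cases) auto
    qed
    have "\<bar>\<nu>' i r\<bar> \<le> C / s" if "i \<le> k" "r \<in> {1..k}" for i r
    proof -
      have "\<bar>\<nu>' i r\<bar> \<le> (\<Sum>u\<le>k. \<bar>(-1) ^ (u + i) * real (u choose i) * gchoose_coeff s u r\<bar>)"
        unfolding \<nu>'_def by (rule sum_abs)
      also have "\<dots> \<le> (\<Sum>u\<le>k. 2 ^ u * ((3 * real k) ^ u / s))"
      proof (rule sum_mono)
        fix u assume u: "u \<in> {..k}"
        have "\<bar>gchoose_coeff s u r\<bar> \<le> (3 * real k) ^ u / s"
          using gchoose_coeff_bound[of s u k r] that u s by (cases "u = 0") auto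
        moreover have "real (u choose i) \<le> 2 ^ u"
          using binomial_le_pow2[of u i] by (metis of_nat_le_iff of_nat_numeral of_nat_power)
        ultimately have "real (u choose i) * \<bar>gchoose_coeff s u r\<bar> \<le> 2 ^ u * ((3 * real k) ^ u / s)"
          by (intro mult_mono) auto
        then show "\<bar>(-1) ^ (u + i) * real (u choose i) * gchoose_coeff s u r\<bar> \<le> 2 ^ u * ((3 * real k) ^ u / s)"
          by (simp add: abs_mult power_abs)
      qed
      also have "\<dots> = (C - 1) / s"
        by (simp add: C_def sum_divide_distrib)
      also have "\<dots> \<le> C / s"
        using s by (simp add: divide_right_mono)
      finally show ?thesis .
    qed
    then show ?thesis
      using W unfolding W_def by (intro exI[of _ \<nu>']) auto
  qed
  moreover have "C > 0"
    unfolding C_def by (intro add_pos_nonneg sum_nonneg) auto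
  ultimately show ?thesis by blast
qed

section \<open>Binomial estimates and the corrected law of a block\<close>

text \<open>For \<open>x = 2 / m \<le> 1 / 2\<close>, the bound
  \<open>ln (1 - x) \<ge> - x - 2 * x\<^sup>2 \<ge> - 2 * x\<close> gives
  \<open>(1 - x) ^ m \<ge> exp (-4)\<close>; a smaller mean or exponent only helps.\<close>

lemma exp_le_one_minus_power:
  assumes "m \<ge> 4" "0 \<le> b" "b \<le> 2 / real m" "M \<le> m"
  shows "exp (-4) \<le> (1 - b) ^ M"
proof -
  define x where "x = 2 / real m"
  have x: "0 \<le> x" "x \<le> 1 / 2" using assms by (auto simp: x_def field_simps)
  have "-2 * x \<le> - x - 2 * x\<^sup>2"
    using mult_left_mono[OF x(2), of "2 * x"] x by (simp add: power2_eq_square)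
  also have "\<dots> \<le> ln (1 - x)"
    using x by (intro ln_one_minus_pos_lower_bound) auto
  finally have "exp (-2 * x) \<le> 1 - x"
    using x by (simp add: ln_ge_iff)
  then have "exp (-2 * x) ^ m \<le> (1 - x) ^ m"
    by (intro power_mono) auto
  moreover have "exp (-2 * x) ^ m = exp (-4)"
    using assms by (simp add: x_def flip: exp_of_nat_mult)
  moreover have "(1 - x) ^ m \<le> (1 - x) ^ M"
    using x assms by (intro power_decreasing) auto
  moreover have "(1 - x) ^ M \<le> (1 - b) ^ M"
    using x assms by (intro power_mono) (auto simp: x_def)
  ultimately show ?thesis by linarith
qed

text \<open>Room for the correction: \<open>m ^ j\<close> from
  \<open>m choose j \<ge> (m / j) ^ j\<close> cancels against \<open>b ^ j\<close>. As for a Poisson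
  variable the bound is free of \<open>m\<close>, with \<open>j ^ j\<close> in place of the
  factorial.\<close>

lemma binomial_mass_lower_bound:
  assumes "m \<ge> 4" "1 / real m \<le> b" "b \<le> 2 / real m" "j \<le> m"
  shows "exp (-4) / real j ^ j \<le> real (m choose j) * (b ^ j * (1 - b) ^ (m - j))"
proof -
  have b: "0 \<le> b" using assms(2) by (rule order_trans[rotated]) simp
  have "(real m / real j) ^ j * (1 / real m) ^ j = 1 / real j ^ j"
    using assms by (simp add: power_divide)
  then have "1 / real j ^ j \<le> real (m choose j) * b ^ j"
    using mult_mono[OF binomial_ge_n_over_k_pow_k[OF assms(4), where 'a = real]
        power_mono[OF assms(2), of j]] by simp
  then have "1 / real j ^ j * exp (-4) \<le> (real (m choose j) * b ^ j) * (1 - b) ^ (m - j)"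
    using assms b exp_le_one_minus_power[of m b "m - j"] by (intro mult_mono) auto
  then show ?thesis by (simp add: ac_simps)
qed

text \<open>This is the gap between the probabilities that \<open>M\<close> bits all vanish under
  the two means. Bernoulli's inequality bounds it below by \<open>exp (-4)\<close> times
  \<open>M\<close> times the difference of the means, and \<open>M \<ge> m / 2\<close>.\<close>

lemma power_diff_lower_bound:
  assumes "m \<ge> 4" "0 \<le> \<delta>" "\<delta> \<le> 1" "m \<le> 2 * M" "M \<le> m"
  shows "\<delta> * exp (-4) / 2 \<le> (1 - 1 / real m) ^ M - (1 - (1 + \<delta>) / real m) ^ M"
proof -
  define y where "y = 1 - (1 + \<delta>) / real m"
  define d where "d = \<delta> / real m"
  have y: "0 < y" "y \<le> 1" and d: "0 \<le> d"
    using assms by (auto simp: y_def d_def field_simps)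
  have x: "1 - 1 / real m = y + d"
    by (simp add: y_def d_def add_divide_distrib)
  have "y ^ M * (1 + M * (d / y)) \<le> y ^ M * (1 + d / y) ^ M"
    using y d by (intro mult_left_mono Bernoulli_inequality) (auto intro: order_trans[of _ 0])
  also have "\<dots> = (y + d) ^ M"
    using y by (simp add: power_mult_distrib[symmetric] distrib_left)
  finally have "y ^ M * (M * (d / y)) \<le> (y + d) ^ M - y ^ M"
    by (simp add: algebra_simps)
  moreover have "exp (-4) * (\<delta> / 2) \<le> y ^ M * (M * (d / y))"
  proof (rule mult_mono)
    show "exp (-4) \<le> y ^ M"
      unfolding y_def using assms by (intro exp_le_one_minus_power) (auto simp: field_simps)
    have "\<delta> / 2 = (m / 2) * d" using assms by (simp add: d_def)
    also have "\<dots> \<le> M * d" using assms d by (intro mult_right_mono) auto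
    also have "\<dots> \<le> M * (d / y)"
      using y d by (intro mult_left_mono) (auto simp: le_divide_eq mult_left_le)
    finally show "\<delta> / 2 \<le> M * (d / y)" .
  qed (use y assms in auto)
  ultimately show ?thesis
    by (simp add: x y_def[symmetric] mult.commute)
qed

text \<open>The shift \<open>\<delta>\<close> of the mean is found by the intermediate value theorem, so that the total
  mass of the correction is exactly \<open>2 * \<epsilon>\<close>.\<close>
lemma ex_correction:
  assumes "k \<ge> 1"
  shows "\<exists>C>0. \<forall>s m \<epsilon>. s \<ge> 1 \<longrightarrow> k * s \<le> m \<longrightarrow> 0 < \<epsilon> \<longrightarrow> 2 * \<epsilon> * real (k * s) \<le> 1 \<longrightarrow>
    (\<exists>\<delta> c. 2 * \<epsilon> * real s / C \<le> \<delta> \<and> \<delta> \<le> 1 \<and> (\<Sum>i\<le>k. \<bar>c i\<bar>) = 2 * \<epsilon> \<and>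
      (\<forall>t\<le>k. (\<Sum>i\<le>k. c i * real ((i * s) choose t)) =
        real (m choose t) * ((1 / real m) ^ t - ((1 + \<delta>) / real m) ^ t)))"
proof -
  obtain C where C: "C > 0" "\<forall>s\<ge>1. \<exists>\<nu> :: nat \<Rightarrow> nat \<Rightarrow> real.
     (\<forall>r\<le>k. \<forall>t\<le>k. (\<Sum>i\<le>k. \<nu> i r * real ((i * s) choose t)) = (if r = t then 1 else 0)) \<and>
     (\<forall>i\<le>k. \<forall>r\<in>{1..k}. \<bar>\<nu> i r\<bar> \<le> C / real s)"
    using ex_dual_weights[of k] by blast
  define C' where "C' = (k + 1) * (\<Sum>r\<le>k. C * 2 ^ r)"
  have C'0: "C' > 0"
    using C(1) by (auto simp: C'_def intro!: mult_pos_pos sum_pos)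
  have "\<exists>\<delta> c. 2 * \<epsilon> * real s / C' \<le> \<delta> \<and> \<delta> \<le> 1 \<and> (\<Sum>i\<le>k. \<bar>c i\<bar>) = 2 * \<epsilon> \<and>
      (\<forall>t\<le>k. (\<Sum>i\<le>k. c i * real ((i * s) choose t)) =
        real (m choose t) * ((1 / real m) ^ t - ((1 + \<delta>) / real m) ^ t))"
    if s: "s \<ge> 1" and m: "k * s \<le> m" and \<epsilon>: "0 < \<epsilon>" and small: "2 * \<epsilon> * real (k * s) \<le> 1"
    for s m :: nat and \<epsilon> :: real
  proof -
    obtain \<nu> where
      dual: "\<forall>r\<le>k. \<forall>t\<le>k. (\<Sum>i\<le>k. \<nu> i r * real ((i * s) choose t)) = (if r = t then 1 else 0)"
      and \<nu>: "\<forall>i\<le>k. \<forall>r\<in>{1..k}. \<bar>\<nu> i r\<bar> \<le> C / real s"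
      using mp[OF spec[OF C(2), of s] s] by (elim exE conjE) (rule that)
    have "k \<le> k * s" using s by simp
    then have km: "k \<le> m" using m by (rule order_trans)
    then have m0: "m > 0" using assms by simp
    \<comment> \<open>The change of the \<open>r\<close>-th binomial moment of the number of ones
      when the mean of \<open>m\<close> independent bits drops from
      \<open>(1 + \<delta>) / m\<close> to \<open>1 / m\<close>. The dual weights turn it into
      signed masses \<open>c \<delta>\<close> on the progression.\<close>
    define e where "e \<delta> r = real (m choose r) * ((1 / real m) ^ r - ((1 + \<delta>) / real m) ^ r)" for \<delta> r
    define c where "c \<delta> i = (\<Sum>r\<le>k. \<nu> i r * e \<delta> r)" for \<delta> i
    define f where "f \<delta> = (\<Sum>i\<le>k. \<bar>c \<delta> i\<bar>)" for \<delta>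
    have moments: "(\<Sum>i\<le>k. c \<delta> i * real ((i * s) choose t)) = e \<delta> t" if "t \<le> k" for \<delta> t
    proof -
      have "(\<Sum>i\<le>k. c \<delta> i * real ((i * s) choose t)) =
          (\<Sum>r\<le>k. (\<Sum>i\<le>k. \<nu> i r * real ((i * s) choose t)) * e \<delta> r)"
        unfolding c_def sum_distrib_right by (subst sum.swap) (simp add: ac_simps)
      also have "\<dots> = (\<Sum>r\<le>k. if r = t then e \<delta> r else 0)"
        using that by (intro sum.cong refl) (simp add: dual)
      finally show ?thesis using that by simp
    qed
    \<comment> \<open>The bound is free of \<open>m\<close> because
      \<open>m choose r \<le> m ^ r\<close> cancels the denominators.\<close>
    have e_bound: "\<bar>e \<delta> r\<bar> \<le> 2 ^ r * \<delta>" if "0 \<le> \<delta>" "\<delta> \<le> 1" "r \<le> k" for \<delta> r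
    proof -
      have pow: "(1 + \<delta>) ^ r - 1 \<le> 2 ^ r * \<delta>" for r
      proof (induction r)
        case (Suc r)
        have "(1 + \<delta>) ^ r \<le> 2 ^ r" using that by (intro power_mono) auto
        then have "(1 + \<delta>) ^ r * \<delta> \<le> 2 ^ r * \<delta>" using that by (intro mult_right_mono) auto
        with Suc show ?case by (simp add: algebra_simps)
      qed (use that in simp)
      have "((1 + \<delta>) / real m) ^ r = (1 + \<delta>) ^ r / m ^ r" "(1 / real m) ^ r = 1 / m ^ r"
        by (simp_all add: power_divide)
      moreover have "1 \<le> (1 + \<delta>) ^ r" using that by simp
      ultimately have "\<bar>e \<delta> r\<bar> = real (m choose r) * (((1 + \<delta>) ^ r - 1) / m ^ r)"
        by (simp only: e_def abs_mult diff_divide_distrib[symmetric])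
          (simp only: abs_divide abs_of_nat abs_minus_commute[of 1] abs_of_nonneg[OF diff_ge_0_iff_ge[THEN iffD2]] of_nat_power[symmetric])
      also have "\<dots> \<le> real (m ^ r) * (((1 + \<delta>) ^ r - 1) / m ^ r)"
        using binomial_le_pow[of r m] that km \<open>1 \<le> (1 + \<delta>) ^ r\<close>
        by (intro mult_right_mono) (auto simp del: of_nat_power)
      also have "\<dots> = (1 + \<delta>) ^ r - 1" using m0 by simp
      finally show ?thesis using pow[of r] by simp
    qed
    have upper: "f \<delta> \<le> C' * \<delta> / s" if "0 \<le> \<delta>" "\<delta> \<le> 1" for \<delta>
    proof -
      have "\<bar>c \<delta> i\<bar> \<le> (\<Sum>r\<le>k. C * 2 ^ r) * \<delta> / s" if "i \<le> k" for i
      proof -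
        have "\<bar>c \<delta> i\<bar> \<le> (\<Sum>r\<le>k. \<bar>\<nu> i r * e \<delta> r\<bar>)"
          unfolding c_def by (rule sum_abs)
        also have "\<dots> \<le> (\<Sum>r\<le>k. C / s * (2 ^ r * \<delta>))"
        proof (rule sum_mono)
          fix r assume r: "r \<in> {..k}"
          show "\<bar>\<nu> i r * e \<delta> r\<bar> \<le> C / s * (2 ^ r * \<delta>)"
          \<comment> \<open>For \<open>r = 0\<close> the moment change is zero, which makes up for
            the missing bound on \<open>\<nu> i 0\<close>.\<close>
          proof (cases "r = 0")
            case True
            then show ?thesis using C(1) \<open>0 \<le> \<delta>\<close> by (simp add: e_def)
          next
            case False
            then have "\<bar>\<nu> i r\<bar> \<le> C / s"
              using \<nu> \<open>i \<le> k\<close> r by simp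
            then show ?thesis
              unfolding abs_mult using e_bound[of \<delta> r] r that \<open>0 \<le> \<delta>\<close> \<open>\<delta> \<le> 1\<close> C(1)
              by (intro mult_mono) auto
          qed
        qed
        also have "\<dots> = (\<Sum>r\<le>k. C * 2 ^ r) * \<delta> / s"
          by (simp add: sum_distrib_right sum_divide_distrib mult.assoc)
        finally show ?thesis .
      qed
      then have "f \<delta> \<le> (\<Sum>i\<le>k. (\<Sum>r\<le>k. C * 2 ^ r) * \<delta> / s)"
        unfolding f_def by (intro sum_mono) auto
      then show ?thesis by (simp add: C'_def algebra_simps)
    qed
    \<comment> \<open>The first moment alone forces this much mass, since all points are at most
      \<open>k * s\<close>. It supplies the right end of the interval for the intermediate value
      theorem, while \<open>upper\<close> gives the lower bound on the \<open>\<delta>\<close> found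
      there.\<close>
    have lower: "\<delta> \<le> k * s * f \<delta>" if "0 \<le> \<delta>" for \<delta>
    proof -
      have "\<delta> = \<bar>e \<delta> 1\<bar>"
        using m0 that by (simp add: e_def diff_divide_distrib[symmetric])
      also have "e \<delta> 1 = (\<Sum>i\<le>k. c \<delta> i * real (i * s))"
        using moments[of 1 \<delta>] assms by simp
      also have "\<bar>\<dots>\<bar> \<le> (\<Sum>i\<le>k. \<bar>c \<delta> i\<bar> * real (k * s))"
        by (intro order_trans[OF sum_abs] sum_mono) (auto simp: abs_mult intro!: mult_left_mono mult_right_mono)
      finally show ?thesis
        by (simp add: f_def sum_distrib_left mult.commute)
    qed
    have cont: "continuous_on {0..2 * \<epsilon> * real (k * s)} f"
      unfolding f_def c_def e_def by (intro continuous_intros) (use m0 in auto)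
    have "f 0 \<le> 2 * \<epsilon>"
      using \<epsilon> by (simp add: f_def c_def e_def)
    moreover have "2 * \<epsilon> \<le> f (2 * \<epsilon> * real (k * s))"
    proof -
      have "2 * \<epsilon> * real (k * s) \<le> real (k * s) * f (2 * \<epsilon> * real (k * s))"
        using lower[of "2 * \<epsilon> * real (k * s)"] \<epsilon> by simp
      then show ?thesis
        using s assms by (simp add: mult.commute mult_le_cancel_left)
    qed
    ultimately obtain \<delta> where \<delta>: "0 \<le> \<delta>" "\<delta> \<le> 2 * \<epsilon> * real (k * s)" "f \<delta> = 2 * \<epsilon>"
      using IVT'[OF _ _ _ cont, of "2 * \<epsilon>"] \<epsilon> by auto
    then have "\<delta> \<le> 1" using small by linarith
    moreover have "2 * \<epsilon> * s / C' \<le> \<delta>"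
      using upper[of \<delta>] \<delta> \<open>\<delta> \<le> 1\<close> s C'0 by (simp add: field_simps)
    ultimately show ?thesis
      using \<delta>(3) moments unfolding f_def e_def by (intro exI[of _ \<delta>] exI[of _ "c \<delta>"]) blast
  qed
  with C'0 show ?thesis by blast
qed

lemma sum_progression:
  fixes s k m :: nat
  assumes "s \<ge> 1" "k * s \<le> m"
  shows "(\<Sum>j\<le>m. if s dvd j \<and> j \<le> k * s then \<phi> j else 0) = (\<Sum>i\<le>k. \<phi> (i * s))"
proof -
  have "(\<Sum>j\<le>m. if s dvd j \<and> j \<le> k * s then \<phi> j else 0) = (\<Sum>j\<in>{j. s dvd j \<and> j \<le> k * s}. \<phi> j)"
    using assms(2) by (intro sum.mono_neutral_cong_right) auto
  also have "\<dots> = (\<Sum>i\<le>k. \<phi> (i * s))"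
    using assms(1) by (intro sum.reindex_bij_witness[of _ "\<lambda>i. i * s" "\<lambda>j. j div s"])
      (auto simp: div_le_mono dest: div_le_mono[of _ _ s])
  finally show ?thesis .
qed

text \<open>\<open>A j\<close> is the mass of each single pattern with \<open>j\<close> ones in the
  block, and the last condition says that \<open>t \<le> k\<close> given coordinates are all one
  with probability \<open>(1 / m) ^ t\<close>. The correction sits at multiples of \<open>s\<close>
  up to \<open>k * s\<close>, where the hypothesis on \<open>(k * s) ^ (k * s)\<close> keeps it
  below the binomial mass.\<close>

lemma ex_matching_density:
  assumes k: "k \<ge> 1"
  shows "\<exists>C>0. \<forall>s m \<epsilon>. s \<ge> 1 \<longrightarrow> k * s \<le> m \<longrightarrow> 4 \<le> m \<longrightarrow> 0 < \<epsilon> \<longrightarrow> 2 * \<epsilon> * real (k * s) \<le> 1 \<longrightarrow>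
    2 * \<epsilon> * real (k * s) ^ (k * s) \<le> exp (-4) \<longrightarrow>
    (\<exists>\<delta> A. 2 * \<epsilon> * real s / C \<le> \<delta> \<and> \<delta> \<le> 1 \<and> (\<forall>j\<le>m. 0 \<le> A j) \<and>
      (\<Sum>j\<le>m. real (m choose j) * \<bar>A j - ((1 + \<delta>) / m) ^ j * (1 - (1 + \<delta>) / m) ^ (m - j)\<bar>) = 2 * \<epsilon> \<and>
      (\<forall>t\<le>k. (\<Sum>z\<le>m - t. real ((m - t) choose z) * A (t + z)) = (1 / real m) ^ t))"
proof -
  obtain C where C: "C > 0" and corr: "\<And>s m \<epsilon>. s \<ge> 1 \<Longrightarrow> k * s \<le> m \<Longrightarrow> 0 < \<epsilon> \<Longrightarrow>
      2 * \<epsilon> * real (k * s) \<le> 1 \<Longrightarrow>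
    \<exists>\<delta> c. 2 * \<epsilon> * real s / C \<le> \<delta> \<and> \<delta> \<le> 1 \<and> (\<Sum>i\<le>k. \<bar>c i\<bar>) = 2 * \<epsilon> \<and>
      (\<forall>t\<le>k. (\<Sum>i\<le>k. c i * real ((i * s) choose t)) =
        real (m choose t) * ((1 / real m) ^ t - ((1 + \<delta>) / real m) ^ t))"
    using ex_correction[OF k] by blast
  have "\<exists>\<delta> A. 2 * \<epsilon> * real s / C \<le> \<delta> \<and> \<delta> \<le> 1 \<and> (\<forall>j\<le>m. 0 \<le> A j) \<and>
      (\<Sum>j\<le>m. real (m choose j) * \<bar>A j - ((1 + \<delta>) / m) ^ j * (1 - (1 + \<delta>) / m) ^ (m - j)\<bar>) = 2 * \<epsilon> \<and>
      (\<forall>t\<le>k. (\<Sum>z\<le>m - t. real ((m - t) choose z) * A (t + z)) = (1 / real m) ^ t)"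
    if s: "s \<ge> 1" and m: "k * s \<le> m" "4 \<le> m" and \<epsilon>: "0 < \<epsilon>" and small: "2 * \<epsilon> * real (k * s) \<le> 1"
      and small': "2 * \<epsilon> * real (k * s) ^ (k * s) \<le> exp (-4)" for s m :: nat and \<epsilon> :: real
  proof -
    obtain \<delta> c where \<delta>: "2 * \<epsilon> * real s / C \<le> \<delta>" "\<delta> \<le> 1" and c: "(\<Sum>i\<le>k. \<bar>c i\<bar>) = 2 * \<epsilon>"
      and moments: "\<And>t. t \<le> k \<Longrightarrow> (\<Sum>i\<le>k. c i * real ((i * s) choose t)) =
        real (m choose t) * ((1 / real m) ^ t - ((1 + \<delta>) / real m) ^ t)"
      using corr[OF s m(1) \<epsilon> small] by blast
    have "0 \<le> 2 * \<epsilon> * real s / C" using \<epsilon> C by simp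
    then have \<delta>0: "0 \<le> \<delta>" using \<delta>(1) by linarith
    have "k \<le> k * s" using s by simp
    then have km: "k \<le> m" using m(1) by (rule order_trans)
    define b where "b = (1 + \<delta>) / real m"
    have b: "1 / real m \<le> b" "b \<le> 2 / real m" "0 \<le> b" "b \<le> 1"
      using \<delta> \<delta>0 m by (auto simp: b_def field_simps)
    \<comment> \<open>The mass \<open>c i\<close> at \<open>i * s\<close> ones is spread evenly over
      all patterns with that many ones.\<close>
    define \<eta> where "\<eta> j = (if s dvd j \<and> j \<le> k * s then c (j div s) / real (m choose j) else 0)" for j
    define A where "A j = b ^ j * (1 - b) ^ (m - j) + \<eta> j" for j
    have "0 \<le> A j" if "j \<le> m" for j
    proof (cases "s dvd j \<and> j \<le> k * s")
      case True
      have pos: "0 < real (m choose j)" using that by simp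
      have "j div s \<le> k" using True s by (metis div_le_mono div_mult_self_is_m less_eq_Suc_le One_nat_def)
      then have "\<bar>c (j div s)\<bar> \<le> (\<Sum>i\<le>k. \<bar>c i\<bar>)"
        by (intro member_le_sum) auto
      also have "\<dots> \<le> exp (-4) / real j ^ j"
      proof (cases "j = 0")
        case True
        have "2 * \<epsilon> * 1 \<le> 2 * \<epsilon> * real (k * s) ^ (k * s)"
          using \<epsilon> k s by (intro mult_left_mono one_le_power) (auto simp flip: of_nat_mult)
        then show ?thesis using True c small' by simp
      next
        case False
        have "real j ^ j \<le> real (k * s) ^ j" 
          using True by (intro power_mono) (auto simp flip: of_nat_mult)
        also have "\<dots> \<le> real (k * s) ^ (k * s)"
          using True k s by (intro power_increasing) (auto simp flip: of_nat_mult)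
        finally have "2 * \<epsilon> * real j ^ j \<le> 2 * \<epsilon> * real (k * s) ^ (k * s)"
          using \<epsilon> by (intro mult_left_mono) auto
        then show ?thesis using False c small' by (simp add: le_divide_eq)
      qed
      also have "\<dots> \<le> real (m choose j) * (b ^ j * (1 - b) ^ (m - j))"
        using m b that by (intro binomial_mass_lower_bound) auto
      finally have "\<bar>c (j div s)\<bar> / real (m choose j) \<le> b ^ j * (1 - b) ^ (m - j)"
        using pos by (simp add: divide_le_eq mult.commute)
      moreover have "- (\<bar>c (j div s)\<bar> / real (m choose j)) \<le> \<eta> j"
        using divide_right_mono[of "- \<bar>c (j div s)\<bar>" "c (j div s)" "real (m choose j)"] True
        by (simp add: \<eta>_def)
      ultimately show ?thesis by (simp add: A_def)
    next
      case False
      then have "\<eta> j = 0" by (simp only: \<eta>_def if_False)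
      then show ?thesis using b by (simp add: A_def)
    qed
    moreover have "(\<Sum>j\<le>m. real (m choose j) * \<bar>A j - b ^ j * (1 - b) ^ (m - j)\<bar>) = 2 * \<epsilon>"
    proof -
      have "(\<Sum>j\<le>m. real (m choose j) * \<bar>A j - b ^ j * (1 - b) ^ (m - j)\<bar>) =
          (\<Sum>j\<le>m. if s dvd j \<and> j \<le> k * s then \<bar>c (j div s)\<bar> else 0)"
        by (intro sum.cong refl) (auto simp: A_def \<eta>_def)
      also have "\<dots> = (\<Sum>i\<le>k. \<bar>c i\<bar>)"
        using sum_progression[OF s m(1), of "\<lambda>j. \<bar>c (j div s)\<bar>"] s by simp
      finally show ?thesis using c by simp
    qed
    moreover have "(\<Sum>z\<le>m - t. real ((m - t) choose z) * A (t + z)) = (1 / real m) ^ t" if t: "t \<le> k" for t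
    proof -
      have tm: "t \<le> m" using t km by simp
      have "(\<Sum>z\<le>m - t. real ((m - t) choose z) * (b ^ (t + z) * (1 - b) ^ (m - (t + z)))) =
          b ^ t * (\<Sum>z\<le>m - t. real ((m - t) choose z) * b ^ z * (1 - b) ^ (m - t - z))"
        unfolding sum_distrib_left by (intro sum.cong refl) (simp add: power_add)
      also have "\<dots> = b ^ t"
        using binomial_ring[of b "1 - b" "m - t"] by simp
      finally have main: "(\<Sum>z\<le>m - t. real ((m - t) choose z) * (b ^ (t + z) * (1 - b) ^ (m - (t + z)))) = b ^ t" .
      \<comment> \<open>Multiplication by \<open>m choose t\<close> turns the sum over patterns
        containing \<open>t\<close> given coordinates into the \<open>t\<close>-th binomial moment,
        for which \<open>c\<close> was built.\<close>
      have choose: "real (m choose t) * real ((m - t) choose z) = real (m choose (t + z)) * real ((t + z) choose t)"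
        if "z \<le> m - t" for z
        using choose_mult[of t "t + z" m] that tm by (simp flip: of_nat_mult)
      have "real (m choose t) * (\<Sum>z\<le>m - t. real ((m - t) choose z) * \<eta> (t + z)) =
          (\<Sum>z\<le>m - t. real (m choose (t + z)) * real ((t + z) choose t) * \<eta> (t + z))"
        unfolding sum_distrib_left by (intro sum.cong refl) (simp add: choose[symmetric])
      also have "\<dots> = (\<Sum>j\<in>{t..m}. real (m choose j) * real (j choose t) * \<eta> j)"
        using tm by (intro sum.reindex_bij_witness[of _ "\<lambda>j. j - t" "\<lambda>z. t + z"]) auto
      also have "\<dots> = (\<Sum>j\<le>m. real (m choose j) * real (j choose t) * \<eta> j)"
        by (rule sum.mono_neutral_left) auto
      also have "\<dots> = (\<Sum>j\<le>m. if s dvd j \<and> j \<le> k * s then c (j div s) * real (j choose t) else 0)"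
        by (intro sum.cong refl) (auto simp: \<eta>_def)
      also have "\<dots> = (\<Sum>i\<le>k. c i * real ((i * s) choose t))"
        using sum_progression[OF s m(1), of "\<lambda>j. c (j div s) * real (j choose t)"] s by simp
      also have "\<dots> = real (m choose t) * ((1 / real m) ^ t - b ^ t)"
        using moments[OF t] by (simp add: b_def)
      finally have "(\<Sum>z\<le>m - t. real ((m - t) choose z) * \<eta> (t + z)) = (1 / real m) ^ t - b ^ t"
        using tm by simp
      with main show ?thesis
        by (simp add: A_def distrib_left sum.distrib)
    qed
    ultimately show ?thesis
      using \<delta> unfolding b_def by (intro exI[of _ \<delta>] exI[of _ A]) blast
  qed
  with C show ?thesis by blast
qed

text \<open>With \<open>L = ln (1 / \<epsilon>)\<close>, the spacing \<open>s\<close> is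
  \<open>L / (2 * k * ln L)\<close> rounded down: then
  \<open>(k * s) ^ (k * s) \<le> exp (L / 2)\<close>, so the correction fits, while
  \<open>\<delta>\<close> keeps the order \<open>\<epsilon> * L / ln L\<close>. The range of
  \<open>M\<close> covers the size of the difference of two blocks sharing at most \<open>k\<close>
  points.\<close>

lemma ex_hidden_block:
  assumes k: "k \<ge> 1"
  shows "\<exists>c>0. \<forall>\<^sub>F \<epsilon> in at_right 0. \<exists>(m::nat) a b A. k < m \<and> 0 < a \<and> a < 1 \<and> 0 \<le> b \<and> b \<le> 1 \<and>
    (\<forall>j\<le>m. 0 \<le> A j) \<and>
    (\<Sum>j\<le>m. real (m choose j) * \<bar>A j - b ^ j * (1 - b) ^ (m - j)\<bar>) = 2 * \<epsilon> \<and>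
    (\<forall>t\<le>k. (\<Sum>z\<le>m - t. real ((m - t) choose z) * A (t + z)) = a ^ t) \<and>
    (\<forall>M. m - k \<le> M \<longrightarrow> M \<le> m \<longrightarrow> c * (\<epsilon> * ln (1 / \<epsilon>) / ln (ln (1 / \<epsilon>))) \<le> (1 - a) ^ M - (1 - b) ^ M)"
proof -
  obtain C where C: "C > 0" and dens: "\<And>s m \<epsilon>. s \<ge> 1 \<Longrightarrow> k * s \<le> m \<Longrightarrow> 4 \<le> m \<Longrightarrow> 0 < \<epsilon> \<Longrightarrow>
      2 * \<epsilon> * real (k * s) \<le> 1 \<Longrightarrow> 2 * \<epsilon> * real (k * s) ^ (k * s) \<le> exp (-4) \<Longrightarrow>
    \<exists>\<delta> A. 2 * \<epsilon> * real s / C \<le> \<delta> \<and> \<delta> \<le> 1 \<and> (\<forall>j\<le>m. 0 \<le> A j) \<and>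
      (\<Sum>j\<le>m. real (m choose j) * \<bar>A j - ((1 + \<delta>) / m) ^ j * (1 - (1 + \<delta>) / m) ^ (m - j)\<bar>) = 2 * \<epsilon> \<and>
      (\<forall>t\<le>k. (\<Sum>z\<le>m - t. real ((m - t) choose z) * A (t + z)) = (1 / real m) ^ t)"
    using ex_matching_density[OF k] by blast
  \<comment> \<open>Collects the losses from rounding \<open>x\<close> down to
    \<open>s \<ge> x / 2\<close>, from \<open>\<delta> \<ge> 2 * \<epsilon> * s / C\<close>, and the
    factor \<open>exp (-4) / 2\<close> of \<open>power_diff_lower_bound\<close>.\<close>
  define c where "c = exp (-4) / (4 * real k * C)"
  have "\<forall>\<^sub>F \<epsilon> in at_right (0::real). 1 \<le> ln (1 / \<epsilon>) / (2 * k * ln (ln (1 / \<epsilon>)))"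
    "\<forall>\<^sub>F \<epsilon> in at_right (0::real). 10 \<le> ln (1 / \<epsilon>)"
    "\<forall>\<^sub>F \<epsilon> in at_right (0::real). 1 \<le> ln (ln (1 / \<epsilon>))"
    "\<forall>\<^sub>F \<epsilon> in at_right (0::real). 2 * \<epsilon> * ln (1 / \<epsilon>) \<le> 1"
    "\<forall>\<^sub>F \<epsilon> in at_right 0. (0::real) < \<epsilon>"
    using k by (real_asymp, real_asymp, real_asymp, real_asymp, simp add: eventually_at_right_less)
  then have "\<forall>\<^sub>F \<epsilon> in at_right 0. \<exists>(m::nat) a b A. k < m \<and> 0 < a \<and> a < 1 \<and> 0 \<le> b \<and> b \<le> 1 \<and>
    (\<forall>j\<le>m. 0 \<le> A j) \<and>
    (\<Sum>j\<le>m. real (m choose j) * \<bar>A j - b ^ j * (1 - b) ^ (m - j)\<bar>) = 2 * \<epsilon> \<and>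
    (\<forall>t\<le>k. (\<Sum>z\<le>m - t. real ((m - t) choose z) * A (t + z)) = a ^ t) \<and>
    (\<forall>M. m - k \<le> M \<longrightarrow> M \<le> m \<longrightarrow> c * (\<epsilon> * ln (1 / \<epsilon>) / ln (ln (1 / \<epsilon>))) \<le> (1 - a) ^ M - (1 - b) ^ M)"
  proof eventually_elim
    case (elim \<epsilon>)
    define L where "L = ln (1 / \<epsilon>)"
    \<comment> \<open>These give, in order: \<open>s \<ge> 1\<close>,
      \<open>2 * exp (- (L / 2)) \<le> exp (-4)\<close>, \<open>k * s \<le> L\<close>, and
      \<open>2 * \<epsilon> * (k * s) \<le> 1\<close>.\<close>
    have L: "1 \<le> L / (2 * k * ln L)" "10 \<le> L" "1 \<le> ln L" "2 * \<epsilon> * L \<le> 1"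
      using elim by (simp_all add: L_def)
    have \<epsilon>: "\<epsilon> > 0" "\<epsilon> = exp (- L)"
      using elim by (simp_all add: L_def ln_div)
    define x where "x = L / (2 * k * ln L)"
    define s where "s = nat \<lfloor>x\<rfloor>"
    have "1 \<le> \<lfloor>x\<rfloor>" using L(1) by (simp add: x_def)
    then have s: "1 \<le> s" "real s \<le> x" "x / 2 \<le> real s"
      unfolding s_def by linarith+
    have "real k * real s \<le> k * x" using s by (intro mult_left_mono) auto
    also have "\<dots> = L / (2 * ln L)" using k by (simp add: x_def)
    finally have ks: "real (k * s) \<le> L / (2 * ln L)" by simp
    moreover have "L / (2 * ln L) \<le> L"
      using L by (simp add: divide_le_eq mult_le_cancel_left1)
    ultimately have ksL: "real (k * s) \<le> L" by linarith
    \<comment> \<open>The summand \<open>2 * k\<close> ensures \<open>m \<le> 2 * M\<close> for all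
      \<open>M \<ge> m - k\<close>, as the gap estimate requires.\<close>
    define m where "m = k * s + 2 * k + 4"
    have "2 * \<epsilon> * real (k * s) \<le> 2 * \<epsilon> * L" using \<epsilon> ksL by (intro mult_left_mono) auto
    then have small: "2 * \<epsilon> * real (k * s) \<le> 1" using L by linarith
    have small': "2 * \<epsilon> * real (k * s) ^ (k * s) \<le> exp (-4)"
    proof -
      have "real (k * s) ^ (k * s) \<le> L ^ (k * s)" using ksL by (intro power_mono) auto
      also have "\<dots> = exp (real (k * s) * ln L)"
        using L exp_of_nat_mult[of "k * s" "ln L"] by (simp del: of_nat_mult)
      also have "\<dots> \<le> exp (L / 2)"
        using ks L by (simp add: le_divide_eq)
      finally have "2 * \<epsilon> * real (k * s) ^ (k * s) \<le> 2 * \<epsilon> * exp (L / 2)"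
        using \<epsilon> by (intro mult_left_mono) auto
      also have "\<dots> = 2 * exp (- (L / 2))"
        by (simp add: \<epsilon>(2) flip: exp_add)
      also have "\<dots> \<le> exp 1 * exp (-5)"
        using L exp_ge_add_one_self[of "1::real"] by (intro mult_mono) auto
      also have "\<dots> = exp (-4)" by (simp flip: exp_add)
      finally show ?thesis .
    qed
    obtain \<delta> A where \<delta>: "2 * \<epsilon> * real s / C \<le> \<delta>" "\<delta> \<le> 1" and A: "\<forall>j\<le>m. 0 \<le> A j"
      "(\<Sum>j\<le>m. real (m choose j) * \<bar>A j - ((1 + \<delta>) / m) ^ j * (1 - (1 + \<delta>) / m) ^ (m - j)\<bar>) = 2 * \<epsilon>"
      "\<forall>t\<le>k. (\<Sum>z\<le>m - t. real ((m - t) choose z) * A (t + z)) = (1 / real m) ^ t"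
      using dens[of s m \<epsilon>] s small small' \<epsilon> by (auto simp: m_def)
    have "0 \<le> 2 * \<epsilon> * real s / C" using \<epsilon> C by simp
    then have \<delta>0: "0 \<le> \<delta>" using \<delta>(1) by linarith
    have "c * (\<epsilon> * L / ln L) \<le> (1 - 1 / real m) ^ M - (1 - (1 + \<delta>) / real m) ^ M"
      if M: "m - k \<le> M" "M \<le> m" for M
    proof -
      have "c * (\<epsilon> * L / ln L) = (2 * \<epsilon> * (x / 2) / C) * exp (-4) / 2"
        using k by (simp add: c_def x_def field_simps)
      also have "\<dots> \<le> (2 * \<epsilon> * s / C) * exp (-4) / 2"
        using s \<epsilon> C by (intro divide_right_mono mult_right_mono mult_left_mono) auto
      also have "\<dots> \<le> \<delta> * exp (-4) / 2"
        using \<delta> by (intro divide_right_mono mult_right_mono) auto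
      also have "\<dots> \<le> (1 - 1 / real m) ^ M - (1 - (1 + \<delta>) / real m) ^ M"
        using \<delta>0 \<delta> M by (intro power_diff_lower_bound) (auto simp: m_def)
      finally show ?thesis .
    qed
    moreover have "k < m" "4 \<le> m"
      by (simp_all add: m_def)
    moreover from this have "0 < 1 / real m" "1 / real m < 1" "0 \<le> (1 + \<delta>) / real m" "(1 + \<delta>) / real m \<le> 1"
      using \<delta>0 \<delta>(2) by (simp_all add: divide_le_eq)
    ultimately show ?case
      using A unfolding L_def[symmetric] by blast
  qed
  moreover have "c > 0" using k C by (simp add: c_def)
  ultimately show ?thesis by blast
qed

subsection \<open>Hiding a block\<close>

text \<open>Points of \<open>X\<close> outside \<open>V\<close> are ignored, so for one and the same
  \<open>X\<close> the weights over disjoint sets of coordinates multiply.\<close>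

definition bern_weight :: "(nat \<Rightarrow> real) \<Rightarrow> nat set \<Rightarrow> nat set \<Rightarrow> real" where
  "bern_weight \<beta> V X = (\<Prod>i\<in>V. if i \<in> X then \<beta> i else 1 - \<beta> i)"

lemma bern_weight_Un:
  "finite U \<Longrightarrow> finite V \<Longrightarrow> U \<inter> V = {} \<Longrightarrow>
    bern_weight \<beta> (U \<union> V) X = bern_weight \<beta> U X * bern_weight \<beta> V X"
  by (simp add: bern_weight_def prod.union_disjoint)

lemma bern_weight_cong:
  "(\<And>i. i \<in> V \<Longrightarrow> \<beta> i = \<beta>' i) \<Longrightarrow> X \<inter> V = X' \<inter> V \<Longrightarrow> bern_weight \<beta> V X = bern_weight \<beta>' V X'"
  unfolding bern_weight_def by (intro prod.cong refl) (auto simp: set_eq_iff)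

lemma bern_weight_const:
  assumes "finite V" "X \<subseteq> V"
  shows "bern_weight (\<lambda>_. a) V X = a ^ card X * (1 - a) ^ (card V - card X)"
proof -
  have "{i\<in>V. i \<in> X} = X" "{i\<in>V. i \<notin> X} = V - X" using assms(2) by auto
  moreover have "card (V - X) = card V - card X"
    using assms by (intro card_Diff_subset) (auto intro: finite_subset)
  ultimately show ?thesis
    using assms(1) by (simp add: bern_weight_def prod.If_cases Int_def Compl_eq conj_commute)
qed

lemma bern_weight_nonneg: "(\<And>i. \<beta> i \<in> {0..1}) \<Longrightarrow> 0 \<le> bern_weight \<beta> V X"
  unfolding bern_weight_def by (intro prod_nonneg) auto

lemma sum_bern_weight:
  assumes "finite V"
  shows "(\<Sum>X\<in>Pow V. bern_weight \<beta> V X) = 1"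
proof -
  have "bern_weight \<beta> V X = (\<Prod>i\<in>X. \<beta> i) * (\<Prod>i\<in>V - X. 1 - \<beta> i)" if "X \<in> Pow V" for X
  proof -
    have "bern_weight \<beta> V X = bern_weight \<beta> X X * bern_weight \<beta> (V - X) X"
      using bern_weight_Un[of X "V - X" \<beta> X] that assms
      by (auto simp: Un_absorb1 intro: finite_subset)
    then show ?thesis by (simp add: bern_weight_def cong: prod.cong_simp)
  qed
  then show ?thesis
    using prod_add[OF assms, of \<beta> "\<lambda>i. 1 - \<beta> i"] by simp
qed

lemma sum_Pow_Un:
  assumes "U \<inter> V = {}"
  shows "(\<Sum>X\<in>Pow (U \<union> V). f X) = (\<Sum>Y\<in>Pow U. \<Sum>Z\<in>Pow V. f (Y \<union> Z))"
  unfolding sum.cartesian_product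
  by (intro sum.reindex_bij_witness[of _ "\<lambda>(Y, Z). Y \<union> Z" "\<lambda>X. (X \<inter> U, X \<inter> V)"])
    (use assms in \<open>auto intro!: arg_cong[of _ _ f]\<close>)

lemma sum_Pow_card:
  assumes "finite V"
  shows "(\<Sum>X\<in>Pow V. f (card X)) = (\<Sum>j\<le>card V. real (card V choose j) * f j)"
proof -
  have "(\<Sum>X\<in>Pow V. f (card X)) = (\<Sum>j\<le>card V. \<Sum>X\<in>{X\<in>Pow V. card X = j}. f (card X))"
    using assms by (intro sum.group[symmetric]) (auto intro: card_mono)
  also have "\<dots> = (\<Sum>j\<le>card V. \<Sum>X\<in>{X\<in>Pow V. card X = j}. f j)"
    by (intro sum.cong) auto
  also have "\<dots> = (\<Sum>j\<le>card V. real (card V choose j) * f j)"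
    using n_subsets[OF assms] by simp
  finally show ?thesis .
qed

text \<open>The average of \<open>h (y + Z)\<close> for \<open>Z\<close> binomially distributed with parameters \<open>u\<close> and \<open>a\<close>.\<close>
fun binomial_average :: "real \<Rightarrow> (nat \<Rightarrow> real) \<Rightarrow> nat \<Rightarrow> nat \<Rightarrow> real" where
  "binomial_average a h 0 y = h y"
| "binomial_average a h (Suc u) y =
    (1 - a) * binomial_average a h u y + a * binomial_average a h u (Suc y)"

lemma sum_bern_weight_average:
  assumes "finite U"
  shows "(\<Sum>Z\<in>Pow U. bern_weight (\<lambda>_. a) U Z * h (y + card Z)) = binomial_average a h (card U) y"
  using assms
proof (induction U arbitrary: y rule: finite_induct)
  case empty
  then show ?case by (simp add: bern_weight_def)
next
  case (insert x U)
  have fin: "finite Z" if "Z \<in> Pow U" for Z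
    using that insert.hyps by (auto intro: finite_subset)
  have "(\<Sum>Z\<in>Pow ({x} \<union> U). bern_weight (\<lambda>_. a) ({x} \<union> U) Z * h (y + card Z)) =
      (\<Sum>Z\<in>Pow U. bern_weight (\<lambda>_. a) ({x} \<union> U) Z * h (y + card Z)) +
      (\<Sum>Z\<in>Pow U. bern_weight (\<lambda>_. a) ({x} \<union> U) (insert x Z) * h (y + card (insert x Z)))"
    using insert.hyps by (subst sum_Pow_Un) (auto simp: Pow_insert)
  also have "(\<Sum>Z\<in>Pow U. bern_weight (\<lambda>_. a) ({x} \<union> U) Z * h (y + card Z)) =
      (\<Sum>Z\<in>Pow U. (1 - a) * (bern_weight (\<lambda>_. a) U Z * h (y + card Z)))"
    using insert.hyps by (intro sum.cong refl) (auto simp: bern_weight_def)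
  also have "(\<Sum>Z\<in>Pow U. bern_weight (\<lambda>_. a) ({x} \<union> U) (insert x Z) * h (y + card (insert x Z))) =
      (\<Sum>Z\<in>Pow U. a * (bern_weight (\<lambda>_. a) U Z * h (Suc y + card Z)))"
  proof (intro sum.cong refl)
    fix Z assume Z: "Z \<in> Pow U"
    then have "bern_weight (\<lambda>_. a) ({x} \<union> U) (insert x Z) = a * bern_weight (\<lambda>_. a) U Z"
      using insert.hyps bern_weight_cong[of U "\<lambda>_. a" "\<lambda>_. a" "insert x Z" Z]
      by (simp add: bern_weight_Un) (simp add: bern_weight_def)
    moreover have "card (insert x Z) = Suc (card Z)"
      using Z fin insert.hyps by (intro card_insert_disjoint) auto
    ultimately show "bern_weight (\<lambda>_. a) ({x} \<union> U) (insert x Z) * h (y + card (insert x Z)) =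
        a * (bern_weight (\<lambda>_. a) U Z * h (Suc y + card Z))"
      by simp
  qed
  finally show ?case
    using insert.IH[of y] insert.IH[of "Suc y"] insert.hyps
    by (simp add: sum_distrib_left[symmetric])
qed

text \<open>The hypothesis treats \<open>t\<close> revealed coordinates that are all one. Revealing
  one coordinate less averages the cases \<open>y\<close> and \<open>y + 1\<close>; by induction on
  \<open>t - y\<close> two of these three averages vanish, hence so does the third.\<close>

lemma binomial_average_eq_0:
  assumes "\<And>t. t \<le> k \<Longrightarrow> binomial_average a h (m - t) t = 0" and "y \<le> t" "t \<le> k" "k \<le> m" "a \<noteq> 1"
  shows "binomial_average a h (m - t) y = 0"
  using assms(2,3)
proof (induction "t - y" arbitrary: t y)
  case 0
  then show ?case using assms(1)[of t] by simp
next
  case (Suc d)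
  then have "binomial_average a h (m - (t - 1)) y = 0"
    by (intro Suc.hyps(1)) auto
  moreover have "m - (t - 1) = Suc (m - t)"
    using Suc assms(4) by auto
  ultimately have "binomial_average a h (Suc (m - t)) y = 0"
    by (simp only:)
  moreover have "binomial_average a h (m - t) (Suc y) = 0"
    using Suc by (intro Suc.hyps(1)) auto
  ultimately show ?case
    using assms(5) by simp
qed

lemma sum_bern_weight_avoiding:
  assumes "finite V" "U \<subseteq> V"
  shows "(\<Sum>X\<in>Pow (V - U). bern_weight \<beta> V X) = (\<Prod>i\<in>U. 1 - \<beta> i)"
proof -
  have "bern_weight \<beta> V X = (\<Prod>i\<in>U. 1 - \<beta> i) * bern_weight \<beta> (V - U) X" if "X \<in> Pow (V - U)" for X
  proof -
    have "bern_weight \<beta> V X = bern_weight \<beta> U X * bern_weight \<beta> (V - U) X"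
      using bern_weight_Un[of U "V - U" \<beta> X] assms by (auto simp: Un_absorb1 intro: finite_subset)
    moreover have "bern_weight \<beta> U X = (\<Prod>i\<in>U. 1 - \<beta> i)"
      unfolding bern_weight_def using that by (intro prod.cong refl) auto
    ultimately show ?thesis by simp
  qed
  then show ?thesis
    using sum_bern_weight[of "V - U" \<beta>] assms by (simp flip: sum_distrib_left)
qed

lemma sum_bern_weight_marginal:
  assumes "finite V" "S \<subseteq> V"
  shows "(\<Sum>X\<in>Pow V. f (X \<inter> S) * bern_weight \<beta> (V - S) X) = (\<Sum>Y\<in>Pow S. f Y)"
proof -
  have "(\<Sum>X\<in>Pow (S \<union> (V - S)). f (X \<inter> S) * bern_weight \<beta> (V - S) X) =
      (\<Sum>Y\<in>Pow S. \<Sum>Z\<in>Pow (V - S). f Y * bern_weight \<beta> (V - S) Z)"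
  proof (subst sum_Pow_Un, blast, intro sum.cong refl)
    fix Y Z assume YZ: "Y \<in> Pow S" "Z \<in> Pow (V - S)"
    then have "(Y \<union> Z) \<inter> S = Y" by auto
    moreover have "bern_weight \<beta> (V - S) (Y \<union> Z) = bern_weight \<beta> (V - S) Z"
      by (rule bern_weight_cong) (use YZ in auto)
    ultimately show "f ((Y \<union> Z) \<inter> S) * bern_weight \<beta> (V - S) (Y \<union> Z) = f Y * bern_weight \<beta> (V - S) Z"
      by simp
  qed
  also have "\<dots> = (\<Sum>Y\<in>Pow S. f Y)"
    using sum_bern_weight[of "V - S" \<beta>] assms(1) by (simp flip: sum_distrib_left)
  finally show ?thesis
    using assms(2) by (simp add: Un_absorb1)
qed

section \<open>The orthogonal family of corrupted distributions\<close>

text \<open>Ordinary coordinates have mean \<open>a\<close>; the coordinates of the block have mean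
  \<open>b\<close> in the clean distribution. The case \<open>t = 0\<close> of
  \<open>matching\<close> is normalisation, and the cases up to \<open>k\<close> make any
  \<open>k\<close> coordinates of the corrupted block look independent with mean
  \<open>a\<close>.\<close>

locale hidden_block =
  fixes k m n :: nat and a b :: real and A :: "nat \<Rightarrow> real"
  assumes k_less: "k < m" and a: "0 < a" "a < 1" and b: "0 \<le> b" "b \<le> 1"
    and A_nonneg: "\<And>j. j \<le> m \<Longrightarrow> 0 \<le> A j"
    and matching: "\<And>t. t \<le> k \<Longrightarrow> (\<Sum>z\<le>m - t. real ((m - t) choose z) * A (t + z)) = a ^ t"
begin

definition blocks :: "nat set set" where
  "blocks = {S. S \<subseteq> {..<n} \<and> card S = m}"

text \<open>The reference distribution, in which no block is hidden.\<close>

definition D :: "nat set \<Rightarrow> real" where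
  "D = bern_weight (\<lambda>_. a) {..<n}"

definition \<beta> :: "nat set \<Rightarrow> nat \<Rightarrow> real" where
  "\<beta> S i = (if i \<in> S then b else a)"

definition p_weight :: "nat set \<Rightarrow> nat set \<Rightarrow> real" where
  "p_weight S X = A (card (X \<inter> S)) * bern_weight (\<lambda>_. a) ({..<n} - S) X"

text \<open>The density of the corrupted distribution relative to \<open>D\<close>, minus one, as a
  function of the number of ones in the block; the factors outside the block cancel.\<close>

definition h :: "nat \<Rightarrow> real" where
  "h j = A j / (a ^ j * (1 - a) ^ (m - j)) - 1"

lemma finite_block: "S \<in> blocks \<Longrightarrow> finite S"
  by (auto simp: blocks_def intro: finite_subset)

lemma card_Int_block: "S \<in> blocks \<Longrightarrow> card (X \<inter> S) \<le> m"
  using card_mono[OF finite_block, of S "X \<inter> S"] by (auto simp: blocks_def)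

lemma bern_weight_block:
  assumes "S \<in> blocks"
  shows "bern_weight \<gamma> {..<n} X = bern_weight \<gamma> S (X \<inter> S) * bern_weight \<gamma> ({..<n} - S) X"
proof -
  have "bern_weight \<gamma> (S \<union> ({..<n} - S)) X = bern_weight \<gamma> S X * bern_weight \<gamma> ({..<n} - S) X"
    using finite_block[OF assms] by (intro bern_weight_Un) auto
  moreover have "S \<union> ({..<n} - S) = {..<n}" using assms by (auto simp: blocks_def)
  moreover have "bern_weight \<gamma> S X = bern_weight \<gamma> S (X \<inter> S)"
    by (rule bern_weight_cong) auto
  ultimately show ?thesis by simp
qed

lemma q_weight_eq:
  assumes "S \<in> blocks"
  shows "bern_weight (\<beta> S) {..<n} X =
    b ^ card (X \<inter> S) * (1 - b) ^ (m - card (X \<inter> S)) * bern_weight (\<lambda>_. a) ({..<n} - S) X"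
proof -
  have "bern_weight (\<beta> S) S (X \<inter> S) = bern_weight (\<lambda>_. b) S (X \<inter> S)"
    by (rule bern_weight_cong) (auto simp: \<beta>_def)
  moreover have "bern_weight (\<beta> S) ({..<n} - S) X = bern_weight (\<lambda>_. a) ({..<n} - S) X"
    by (rule bern_weight_cong) (auto simp: \<beta>_def)
  ultimately show ?thesis
    using assms finite_block[OF assms] bern_weight_const[of S "X \<inter> S" b]
    by (simp add: bern_weight_block[OF assms] blocks_def)
qed

lemma D_mult_h:
  assumes "S \<in> blocks"
  shows "D X * h (card (X \<inter> S)) = p_weight S X - D X"
proof -
  define w where "w = a ^ card (X \<inter> S) * (1 - a) ^ (m - card (X \<inter> S))"
  have "bern_weight (\<lambda>_. a) S (X \<inter> S) = w"
    unfolding w_def using bern_weight_const[of S "X \<inter> S" a] finite_block[OF assms] assms by (simp add: blocks_def)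
  moreover have "0 < w"
    using a by (simp add: w_def)
  ultimately show ?thesis
    by (simp add: D_def p_weight_def h_def w_def[symmetric] bern_weight_block[OF assms] field_simps)
qed

lemma D_nonneg: "0 \<le> D X"
  unfolding D_def using a by (intro bern_weight_nonneg) auto

lemma sum_D: "(\<Sum>X\<in>Pow {..<n}. D X) = 1"
  by (simp add: D_def sum_bern_weight)

lemma p_weight_nonneg: "S \<in> blocks \<Longrightarrow> 0 \<le> p_weight S X"
  unfolding p_weight_def using a by (intro mult_nonneg_nonneg A_nonneg card_Int_block bern_weight_nonneg) auto

lemma sum_p_weight:
  assumes "S \<in> blocks"
  shows "(\<Sum>X\<in>Pow {..<n}. p_weight S X) = 1"
proof -
  have "(\<Sum>X\<in>Pow {..<n}. p_weight S X) = (\<Sum>Y\<in>Pow S. A (card Y))"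
    unfolding p_weight_def using assms
    by (intro sum_bern_weight_marginal[where f = "\<lambda>Y. A (card Y)"]) (auto simp: blocks_def)
  also have "\<dots> = 1"
    using sum_Pow_card[OF finite_block[OF assms], of A] matching[of 0] assms by (simp add: blocks_def)
  finally show ?thesis .
qed

lemma sum_abs_diff:
  assumes "S \<in> blocks"
  shows "(\<Sum>X\<in>Pow {..<n}. \<bar>p_weight S X - bern_weight (\<beta> S) {..<n} X\<bar>) =
    (\<Sum>j\<le>m. real (m choose j) * \<bar>A j - b ^ j * (1 - b) ^ (m - j)\<bar>)"
proof -
  define f where "f j = \<bar>A j - b ^ j * (1 - b) ^ (m - j)\<bar>" for j
  have "\<bar>p_weight S X - bern_weight (\<beta> S) {..<n} X\<bar> =
      f (card (X \<inter> S)) * bern_weight (\<lambda>_. a) ({..<n} - S) X" for X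
  proof -
    have "0 \<le> bern_weight (\<lambda>_. a) ({..<n} - S) X"
      using a by (intro bern_weight_nonneg) auto
    then show ?thesis
      unfolding p_weight_def q_weight_eq[OF assms] left_diff_distrib[symmetric] abs_mult f_def by simp
  qed
  then have "(\<Sum>X\<in>Pow {..<n}. \<bar>p_weight S X - bern_weight (\<beta> S) {..<n} X\<bar>) = (\<Sum>Y\<in>Pow S. f (card Y))"
    using sum_bern_weight_marginal[of "{..<n}" S "\<lambda>Y. f (card Y)"] assms by (simp add: blocks_def)
  also have "\<dots> = (\<Sum>j\<le>m. real (m choose j) * f j)"
    using sum_Pow_card[OF finite_block[OF assms], of f] assms by (simp add: blocks_def)
  finally show ?thesis by (simp add: f_def)
qed

text \<open>Conditionally on any at most \<open>k\<close> coordinates of the block, \<open>h\<close> averages to zero.\<close>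
lemma average_h_eq_0:
  assumes "y \<le> t" "t \<le> k"
  shows "binomial_average a h (m - t) y = 0"
proof (rule binomial_average_eq_0[OF _ assms])
  fix t assume t: "t \<le> k"
  have "binomial_average a h (m - t) t =
      (\<Sum>Z\<in>Pow {..<m - t}. bern_weight (\<lambda>_. a) {..<m - t} Z * h (t + card Z))"
    by (subst sum_bern_weight_average) auto
  also have "\<dots> = (\<Sum>Z\<in>Pow {..<m - t}. a ^ card Z * (1 - a) ^ (m - t - card Z) * h (t + card Z))"
    by (intro sum.cong refl) (simp add: bern_weight_const)
  also have "\<dots> = (\<Sum>z\<le>m - t. real ((m - t) choose z) * (a ^ z * (1 - a) ^ (m - t - z) * h (t + z)))"
    using sum_Pow_card[of "{..<m - t}" "\<lambda>z. a ^ z * (1 - a) ^ (m - t - z) * h (t + z)"] by simp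
  also have "\<dots> = (\<Sum>z\<le>m - t. real ((m - t) choose z) * A (t + z) / a ^ t -
      real ((m - t) choose z) * a ^ z * (1 - a) ^ (m - t - z))"
    using a by (intro sum.cong refl) (simp add: h_def power_add field_simps)
  also have "\<dots> = (\<Sum>z\<le>m - t. real ((m - t) choose z) * A (t + z)) / a ^ t - (a + (1 - a)) ^ (m - t)"
    unfolding sum_subtractf sum_divide_distrib binomial_ring ..
  also have "\<dots> = 0"
    using matching[OF t] a by simp
  finally show "binomial_average a h (m - t) t = 0" .
qed (use k_less a in auto)

text \<open>Fix all coordinates outside \<open>S - T\<close>. The factor for \<open>T\<close> is
  then constant, and the count in \<open>S\<close> is a number
  \<open>\<le> card (S \<inter> T) \<le> k\<close> plus a binomial variable on the
  \<open>m - card (S \<inter> T)\<close> free coordinates, over which \<open>h\<close> averages to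
  zero.\<close>

lemma orthogonal:
  assumes S: "S \<in> blocks" and T: "T \<in> blocks" and ST: "card (S \<inter> T) \<le> k"
  shows "(\<Sum>X\<in>Pow {..<n}. D X * (h (card (X \<inter> S)) * h (card (X \<inter> T)))) = 0"
proof -
  define U where "U = S - T"
  define V where "V = {..<n} - U"
  have fin: "finite U" "finite V" "finite S" using finite_block[OF S] by (auto simp: U_def V_def)
  have UV: "U \<inter> V = {}" "U \<union> V = {..<n}" using S by (auto simp: U_def V_def blocks_def)
  have cardU: "card U = m - card (S \<inter> T)"
    using S fin by (simp add: U_def card_Diff_subset_Int blocks_def)
  have "(\<Sum>X\<in>Pow (V \<union> U). D X * (h (card (X \<inter> S)) * h (card (X \<inter> T)))) =
      (\<Sum>W\<in>Pow V. \<Sum>Z\<in>Pow U. bern_weight (\<lambda>_. a) V W * h (card (W \<inter> T)) *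
        (bern_weight (\<lambda>_. a) U Z * h (card (W \<inter> S) + card Z)))"
  proof (subst sum_Pow_Un, use UV in blast, intro sum.cong refl)
    fix W Z assume WZ: "W \<in> Pow V" "Z \<in> Pow U"
    have "D (W \<union> Z) = bern_weight (\<lambda>_. a) U (W \<union> Z) * bern_weight (\<lambda>_. a) V (W \<union> Z)"
      unfolding D_def UV(2)[symmetric] using fin UV by (intro bern_weight_Un) auto
    also have "bern_weight (\<lambda>_. a) U (W \<union> Z) = bern_weight (\<lambda>_. a) U Z"
      by (rule bern_weight_cong) (use WZ UV in auto)
    also have "bern_weight (\<lambda>_. a) V (W \<union> Z) = bern_weight (\<lambda>_. a) V W"
      by (rule bern_weight_cong) (use WZ UV in auto)
    finally have "D (W \<union> Z) = bern_weight (\<lambda>_. a) U Z * bern_weight (\<lambda>_. a) V W" .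
    moreover have "card ((W \<union> Z) \<inter> S) = card (W \<inter> S) + card Z"
    proof -
      have "(W \<union> Z) \<inter> S = (W \<inter> S) \<union> Z" using WZ by (auto simp: U_def)
      then show ?thesis
        using WZ fin UV by (simp, intro card_Un_disjoint) (auto intro: finite_subset)
    qed
    moreover have "(W \<union> Z) \<inter> T = W \<inter> T" using WZ by (auto simp: U_def)
    ultimately show "D (W \<union> Z) * (h (card ((W \<union> Z) \<inter> S)) * h (card ((W \<union> Z) \<inter> T))) =
        bern_weight (\<lambda>_. a) V W * h (card (W \<inter> T)) * (bern_weight (\<lambda>_. a) U Z * h (card (W \<inter> S) + card Z))"
      by simp
  qed
  also have "\<dots> = (\<Sum>W\<in>Pow V. bern_weight (\<lambda>_. a) V W * h (card (W \<inter> T)) *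
      binomial_average a h (m - card (S \<inter> T)) (card (W \<inter> S)))"
    using sum_bern_weight_average[OF fin(1), of a h] cardU by (simp flip: sum_distrib_left)
  also have "\<dots> = 0"
  proof (intro sum.neutral ballI)
    fix W assume "W \<in> Pow V"
    then have "card (W \<inter> S) \<le> card (S \<inter> T)"
      using fin by (intro card_mono) (auto simp: U_def V_def)
    then show "bern_weight (\<lambda>_. a) V W * h (card (W \<inter> T)) *
        binomial_average a h (m - card (S \<inter> T)) (card (W \<inter> S)) = 0"
      using average_h_eq_0 ST by simp
  qed
  finally show ?thesis
    using UV by (simp add: Un_commute)
qed

text \<open>A crude bound on the squared norms, independent of \<open>n\<close>; the summand
  \<open>1\<close> gives \<open>B \<ge> 1\<close>.\<close>

definition B :: real where
  "B = 1 + (\<Sum>j\<le>m. (h j)\<^sup>2)"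

lemma norm_bound:
  assumes "S \<in> blocks"
  shows "(\<Sum>X\<in>Pow {..<n}. D X * (h (card (X \<inter> S)))\<^sup>2) \<le> B"
proof -
  have "(\<Sum>X\<in>Pow {..<n}. D X * (h (card (X \<inter> S)))\<^sup>2) \<le> (\<Sum>X\<in>Pow {..<n}. D X * B)"
  proof (intro sum_mono mult_left_mono D_nonneg)
    fix X
    have "(h (card (X \<inter> S)))\<^sup>2 \<le> (\<Sum>j\<le>m. (h j)\<^sup>2)"
      using card_Int_block[OF assms] by (intro member_le_sum) auto
    then show "(h (card (X \<inter> S)))\<^sup>2 \<le> B" by (simp add: B_def)
  qed
  then show ?thesis by (simp add: sum_D flip: sum_distrib_right)
qed

lemma B_ge_1: "1 \<le> B"
  by (simp add: B_def sum_nonneg)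

lemma ex_hidden_distributions:
  assumes "S \<in> blocks"
  shows "\<exists>p q. dist_on_cube n p \<and> product_dist n q \<and>
    (\<forall>X\<subseteq>{..<n}. pmf p (enc n X) = p_weight S X) \<and>
    (\<forall>X\<subseteq>{..<n}. pmf q (enc n X) = bern_weight (\<beta> S) {..<n} X)"
proof -
  have "n > 0"
    using card_mono[of "{..<n}" S] assms k_less by (simp add: blocks_def)
  then have "\<exists>q. product_dist n q \<and> (\<forall>X\<subseteq>{..<n}. pmf q (enc n X) = bern_weight (\<beta> S) {..<n} X)"
    unfolding bern_weight_def using a b by (intro ex_product_pmf) (auto simp: \<beta>_def)
  moreover have "\<exists>p. dist_on_cube n p \<and> (\<forall>X\<subseteq>{..<n}. pmf p (enc n X) = p_weight S X)"
    using assms by (intro ex_cube_pmf p_weight_nonneg sum_p_weight)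
  ultimately show ?thesis by blast
qed

text \<open>The general lower bound is applied to an almost disjoint family of blocks, with the
  expectations under \<open>D\<close> as reference answers.\<close>

lemma sq_hard:
  assumes TV: "(\<Sum>j\<le>m. real (m choose j) * \<bar>A j - b ^ j * (1 - b) ^ (m - j)\<bar>) = 2 * \<epsilon>"
    and sep: "\<And>M. m - k \<le> M \<Longrightarrow> M \<le> m \<Longrightarrow> 2 * \<delta> < (1 - a) ^ M - (1 - b) ^ M"
    and mn: "m \<le> n" and N: "N \<ge> 0" and \<tau>: "\<tau> > 0"
    and large: "(1 + (N + 1) * (B / \<tau>\<^sup>2)) * (real (m choose Suc k))\<^sup>2 < 2 / 3 * real (n choose Suc k)"
    and M: "sq_alg n M" "learns n \<epsilon> \<delta> M"
  shows "can_happen n \<epsilon> M (makes_queries_at_least N) \<or>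
    can_happen n \<epsilon> M (makes_query_of_tolerance_at_most \<tau>)"
proof -
  have "m \<le> card {..<n}" using mn by simp
  then obtain \<F> where fin: "finite \<F>" and members: "\<forall>S\<in>\<F>. S \<subseteq> {..<n} \<and> card S = m"
    and disj: "\<forall>S\<in>\<F>. \<forall>T\<in>\<F>. S \<noteq> T \<longrightarrow> card (S \<inter> T) \<le> k"
    and card: "(card {..<n} choose Suc k) \<le> card \<F> * (m choose Suc k)\<^sup>2"
    using ex_almost_disjoint_family[OF finite_lessThan k_less] by metis
  have \<F>: "\<F> \<subseteq> blocks"
    using members by (auto simp: blocks_def)
  have ex_pq: "\<forall>S\<in>\<F>. \<exists>pq. dist_on_cube n (fst pq) \<and> product_dist n (snd pq) \<and>
    (\<forall>X\<subseteq>{..<n}. pmf (fst pq) (enc n X) = p_weight S X) \<and>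
    (\<forall>X\<subseteq>{..<n}. pmf (snd pq) (enc n X) = bern_weight (\<beta> S) {..<n} X)"
    using ex_hidden_distributions \<F> by (simp add: subset_iff)
  obtain pq where pq: "\<forall>S\<in>\<F>. dist_on_cube n (fst (pq S)) \<and> product_dist n (snd (pq S)) \<and>
    (\<forall>X\<subseteq>{..<n}. pmf (fst (pq S)) (enc n X) = p_weight S X) \<and>
    (\<forall>X\<subseteq>{..<n}. pmf (snd (pq S)) (enc n X) = bern_weight (\<beta> S) {..<n} X)"
    using bchoice[OF ex_pq] by (elim exE) (rule that)
  define p q where "p S = fst (pq S)" and "q S = snd (pq S)" for S
  have p: "dist_on_cube n (p S)" and q: "product_dist n (q S)"
    and pmf_p: "\<And>X. X \<subseteq> {..<n} \<Longrightarrow> pmf (p S) (enc n X) = p_weight S X"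
    and pmf_q: "\<And>X. X \<subseteq> {..<n} \<Longrightarrow> pmf (q S) (enc n X) = bern_weight (\<beta> S) {..<n} X"
    if "S \<in> \<F>" for S
    using bspec[OF pq that] by (simp_all add: p_def q_def)
  have q': "dist_on_cube n (q S)" if "S \<in> \<F>" for S
    using q[OF that] by (simp add: product_dist_def)
  define \<mu> where "\<mu> F = (\<Sum>X\<in>Pow {..<n}. D X * F (enc n X))" for F :: query
  show ?thesis
  proof (rule sq_lower_bound[OF M fin q p, where \<mu> = \<mu> and B = "B / \<tau>\<^sup>2"])
    fix S assume S: "S \<in> \<F>"
    show "d_TV (p S) (q S) = \<epsilon>"
      using sum_abs_diff[of S] TV S \<F>
      by (simp add: d_TV_cube[OF p[OF S] q'[OF S]] sum_cube pmf_p pmf_q subset_iff)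
  next
    fix S T assume ST: "S \<in> \<F>" "T \<in> \<F>" "S \<noteq> T"
    \<comment> \<open>The distinguishing event is that all coordinates in \<open>T - S\<close> are
      zero: they have mean \<open>a\<close> under \<open>q S\<close> and mean \<open>b\<close> under
      \<open>q T\<close>.\<close>
    define U where "U = T - S"
    have blocks: "S \<in> blocks" "T \<in> blocks" using ST \<F> by auto
    have U: "U \<subseteq> {..<n}" using blocks by (auto simp: U_def blocks_def)
    have "card U = m - card (T \<inter> S)"
      unfolding U_def using finite_block[OF blocks(2)] blocks(2)
      by (subst card_Diff_subset_Int) (simp_all add: blocks_def)
    moreover have "card (T \<inter> S) \<le> k"
      using disj ST by metis
    ultimately have cardU: "m - k \<le> card U" "card U \<le> m"
      by auto
    have inj: "inj_on (enc n) (Pow ({..<n} - U))"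
      using bij_betw_enc[of n] by (auto simp: bij_betw_def intro: inj_on_subset)
    have sub: "enc n ` Pow ({..<n} - U) \<subseteq> cube n"
      using bij_betw_enc[of n] by (auto simp: bij_betw_def)
    have event: "(\<Sum>x\<in>enc n ` Pow ({..<n} - U). pmf (q R) x) = (\<Prod>i\<in>U. 1 - \<beta> R i)" if "R \<in> \<F>" for R
    proof -
      have "(\<Sum>x\<in>enc n ` Pow ({..<n} - U). pmf (q R) x) = (\<Sum>X\<in>Pow ({..<n} - U). bern_weight (\<beta> R) {..<n} X)"
        unfolding sum.reindex[OF inj] using pmf_q[OF that] by (intro sum.cong refl) auto
      then show ?thesis
        using U by (simp add: sum_bern_weight_avoiding)
    qed
    have "(\<Prod>i\<in>U. 1 - \<beta> S i) = (1 - a) ^ card U" "(\<Prod>i\<in>U. 1 - \<beta> T i) = (1 - b) ^ card U"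
      by (simp_all add: \<beta>_def U_def cong: prod.cong_simp)
    then have "(1 - a) ^ card U - (1 - b) ^ card U \<le> d_TV (q S) (q T)"
      using d_TV_ge_event[OF q'[OF ST(1)] q'[OF ST(2)] sub] event ST by simp
    then show "2 * \<delta> < d_TV (q S) (q T)"
      using sep[OF cardU] by linarith
  next
    fix F assume F: "stat_query n F"
    \<comment> \<open>Up to sign, the error of the reference answer is the correlation of the query
      with the centred density for \<open>S\<close>, which brings in Bessel's inequality.\<close>
    define v where "v S = (\<Sum>X\<in>Pow {..<n}. D X * (h (card (X \<inter> S)) * F (enc n X)))" for S
    have v: "\<mu> F - measure_pmf.expectation (p S) F = - v S" if S: "S \<in> \<F>" for S
    proof -
      have "measure_pmf.expectation (p S) F = (\<Sum>X\<in>Pow {..<n}. p_weight S X * F (enc n X))"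
        using pmf_p[OF S] by (simp add: expectation_cube[OF p[OF S]] sum_cube)
      moreover have "v S = (\<Sum>X\<in>Pow {..<n}. (p_weight S X - D X) * F (enc n X))"
        unfolding v_def using D_mult_h[of S] S \<F> by (auto simp flip: mult.assoc intro!: sum.cong)
      ultimately show ?thesis
        by (simp add: \<mu>_def left_diff_distrib sum_subtractf)
    qed
    have F1: "(F (enc n X))\<^sup>2 \<le> 1" for X
      using F by (auto simp: stat_query_def abs_square_le_1 abs_le_iff cube_def enc_def)
    have "(\<Sum>X\<in>Pow {..<n}. D X * (F (enc n X))\<^sup>2) \<le> (\<Sum>X\<in>Pow {..<n}. D X * 1)"
      using F1 by (intro sum_mono mult_left_mono D_nonneg) auto
    then have F2: "(\<Sum>X\<in>Pow {..<n}. D X * (F (enc n X))\<^sup>2) \<le> 1"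
      by (simp add: sum_D)
    have "(\<Sum>S\<in>\<F>. (v S)\<^sup>2) \<le> B"
      unfolding v_def
    proof (rule bessel_inequality[where H = "\<lambda>S X. h (card (X \<inter> S))", OF fin D_nonneg F2])
      show "0 < B" using B_ge_1 by simp
      show "(\<Sum>X\<in>Pow {..<n}. D X * (h (card (X \<inter> S)))\<^sup>2) \<le> B" if "S \<in> \<F>" for S
        using norm_bound that \<F> by blast
      show "(\<Sum>X\<in>Pow {..<n}. D X * (h (card (X \<inter> S)) * h (card (X \<inter> T)))) = 0"
        if "S \<in> \<F>" "T \<in> \<F>" "S \<noteq> T" for S T
      proof (rule orthogonal)
        show "S \<in> blocks" "T \<in> blocks" using that \<F> by (simp_all add: subset_iff)
        show "card (S \<inter> T) \<le> k" using disj that by metis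
      qed
    qed
    then have "real (card {S\<in>\<F>. \<bar>v S\<bar> > \<tau>}) \<le> B / \<tau>\<^sup>2"
      using fin \<tau> by (intro card_large_coefficients)
    moreover have "{S\<in>\<F>. \<bar>\<mu> F - measure_pmf.expectation (p S) F\<bar> > \<tau>} = {S\<in>\<F>. \<bar>v S\<bar> > \<tau>}"
      using v by auto
    ultimately show "real (card {S\<in>\<F>. \<bar>\<mu> F - measure_pmf.expectation (p S) F\<bar> > \<tau>}) \<le> B / \<tau>\<^sup>2"
      by simp
  next
    have "real (n choose Suc k) \<le> real (card \<F>) * (real (m choose Suc k))\<^sup>2"
      using card by (simp flip: of_nat_power of_nat_mult)
    then have "(1 + (N + 1) * (B / \<tau>\<^sup>2)) * (real (m choose Suc k))\<^sup>2 < 2 / 3 * real (card \<F>) * (real (m choose Suc k))\<^sup>2"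
      using large by linarith
    then show "1 + (N + 1) * (B / \<tau>\<^sup>2) < 2 / 3 * real (card \<F>)"
      by (rule mult_right_less_imp_less) simp
  qed (use N in auto)
qed

end

section \<open>Counting budget and conclusion\<close>

text \<open>About \<open>n ^ K\<close> queries expose at most \<open>B * n ^ (2 * K)\<close> blocks
  each, against a family of order \<open>n ^ (k + 1)\<close>. As \<open>k \<ge> 3 * K\<close>, a
  factor \<open>n\<close> is left over to absorb all constants.\<close>

lemma eventually_power_budget:
  fixes B Q :: real
  assumes K: "K > 0" and k: "3 * K \<le> real k" and B: "B \<ge> 1" and Q: "Q \<ge> 0"
  shows "\<forall>\<^sub>F n in sequentially.
    (1 + (real n powr K + 1) * (B / (real n powr - K)\<^sup>2)) * Q < 2 / 3 * real (n choose Suc k)"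
proof -
  \<comment> \<open>The constant in \<open>2 / 3 * (n choose Suc k) \<ge> c * n ^ Suc k\<close>,
    from \<open>n choose Suc k \<ge> (n / Suc k) ^ Suc k\<close>.\<close>
  define c where "c = 2 / 3 * (1 / real (Suc k)) ^ Suc k"
  have c: "c > 0" by (simp add: c_def)
  have "\<forall>\<^sub>F n in sequentially. 3 * B * Q / c < real n"
    using filterlim_real_sequentially by (simp add: filterlim_at_top_dense)
  moreover have "\<forall>\<^sub>F n in sequentially. Suc k \<le> n"
    by (rule eventually_ge_at_top)
  ultimately show ?thesis
  proof eventually_elim
    case (elim n)
    define x where "x = real n powr K"
    have n: "1 \<le> real n" using elim by simp
    have x: "1 \<le> x" unfolding x_def using n K by (simp add: ge_one_powr_ge_zero)
    have "x ^ 3 = real n powr (3 * K)"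
      using n by (simp add: x_def powr_powr powr_realpow[symmetric] mult.commute)
    also have "\<dots> \<le> real n powr real k"
      using n k by (intro powr_mono) auto
    also have "\<dots> = real n ^ k"
      using n by (simp add: powr_realpow)
    finally have x3: "x ^ 3 \<le> real n ^ k" .
    have "1 * 1 \<le> B * x ^ 3"
      using B x by (intro mult_mono one_le_power) auto
    moreover have "x\<^sup>2 \<le> x ^ 3"
      using x by (intro power_increasing) auto
    moreover have "(x + 1) * (B * x\<^sup>2) = B * x ^ 3 + B * x\<^sup>2"
      by (simp add: power2_eq_square power3_eq_cube algebra_simps)
    ultimately have "1 + (x + 1) * (B * x\<^sup>2) \<le> 3 * B * x ^ 3"
      using mult_left_mono[of "x\<^sup>2" "x ^ 3" B] B by linarith
    also have "\<dots> \<le> 3 * B * real n ^ k"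
      using x3 B by (intro mult_left_mono) auto
    finally have "(1 + (x + 1) * (B * x\<^sup>2)) * Q \<le> (3 * B * real n ^ k) * Q"
      using Q by (rule mult_right_mono)
    also have "\<dots> = (3 * B * Q) * real n ^ k" by simp
    also have "\<dots> < (c * real n) * real n ^ k"
      using elim(1) c n by (intro mult_strict_right_mono) (auto simp: divide_less_eq mult.commute)
    also have "\<dots> = 2 / 3 * (real n / real (Suc k)) ^ Suc k"
      by (simp add: c_def power_divide)
    also have "\<dots> \<le> 2 / 3 * real (n choose Suc k)"
      using elim(2) by (intro mult_left_mono binomial_ge_n_over_k_pow_k) auto
    finally have "(1 + (x + 1) * (B * x\<^sup>2)) * Q < 2 / 3 * real (n choose Suc k)" .
    moreover have "B / (real n powr - K)\<^sup>2 = B * x\<^sup>2"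
      by (simp add: x_def powr_minus power_inverse field_simps)
    ultimately show ?case
      by (simp add: x_def)
  qed
qed

theorem theorem1p10:
  fixes g :: "real \<Rightarrow> real"
  assumes g_nonneg: "\<And>\<epsilon>. \<epsilon> \<in> {0<..<1} \<Longrightarrow> g \<epsilon> \<ge> 0"
    and g_small: "g \<in> o[at_right 0](\<lambda>\<epsilon>. \<epsilon> * ln (1 / \<epsilon>) / ln (ln (1 / \<epsilon>)))"
  shows "\<forall>K>0. \<exists>\<epsilon>\<^sub>0>0. \<forall>\<epsilon>\<in>{0<..<\<epsilon>\<^sub>0}. \<forall>\<^sub>F n in sequentially.
           \<forall>M :: det_sq_alg measure.
             sq_alg n M \<and> learns n \<epsilon> (g \<epsilon>) M \<longrightarrow>
               can_happen n \<epsilon> M (makes_queries_at_least (real n powr K)) \<or>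
               can_happen n \<epsilon> M (makes_query_of_tolerance_at_most (real n powr - K))"
proof (intro allI impI)
  fix K :: real assume K: "K > 0"
  define \<phi> where "\<phi> \<epsilon> = \<epsilon> * ln (1 / \<epsilon>) / ln (ln (1 / \<epsilon>))" for \<epsilon> :: real
  define k where "k = nat \<lceil>3 * K\<rceil>"
  have k: "k \<ge> 1" "3 * K \<le> real k"
    using K unfolding k_def by linarith+
  obtain c where c: "c > 0" and block: "\<forall>\<^sub>F \<epsilon> in at_right 0. \<exists>(m::nat) a b A.
    k < m \<and> 0 < a \<and> a < 1 \<and> 0 \<le> b \<and> b \<le> 1 \<and> (\<forall>j\<le>m. 0 \<le> A j) \<and>
    (\<Sum>j\<le>m. real (m choose j) * \<bar>A j - b ^ j * (1 - b) ^ (m - j)\<bar>) = 2 * \<epsilon> \<and>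
    (\<forall>t\<le>k. (\<Sum>z\<le>m - t. real ((m - t) choose z) * A (t + z)) = a ^ t) \<and>
    (\<forall>M. m - k \<le> M \<longrightarrow> M \<le> m \<longrightarrow> c * \<phi> \<epsilon> \<le> (1 - a) ^ M - (1 - b) ^ M)"
    using ex_hidden_block[OF k(1), folded \<phi>_def] by (elim exE conjE) (rule that)
  \<comment> \<open>The factor \<open>c / 4\<close> leaves slack: \<open>2 * g \<epsilon>\<close> is
    at most \<open>c / 2 * \<phi> \<epsilon>\<close>, strictly below the separation
    \<open>c * \<phi> \<epsilon>\<close>.\<close>
  have small: "\<forall>\<^sub>F \<epsilon> in at_right 0. norm (g \<epsilon>) \<le> c / 4 * norm (\<phi> \<epsilon>)"
    unfolding \<phi>_def using landau_o.smallD[OF g_small, of "c / 4"] c by simp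
  have pos: "\<forall>\<^sub>F \<epsilon> in at_right 0. \<phi> \<epsilon> > 0"
    unfolding \<phi>_def by real_asymp
  have "\<forall>\<^sub>F \<epsilon> in at_right 0. \<forall>\<^sub>F n in sequentially. \<forall>M :: det_sq_alg measure.
      sq_alg n M \<and> learns n \<epsilon> (g \<epsilon>) M \<longrightarrow>
        can_happen n \<epsilon> M (makes_queries_at_least (real n powr K)) \<or>
        can_happen n \<epsilon> M (makes_query_of_tolerance_at_most (real n powr - K))"
    using block small pos
  proof eventually_elim
    case (elim \<epsilon>)
    obtain m :: nat and a b A where "k < m" "0 < a" "a < 1" "0 \<le> b" "b \<le> 1" "\<forall>j\<le>m. 0 \<le> A j"
      and TV: "(\<Sum>j\<le>m. real (m choose j) * \<bar>A j - b ^ j * (1 - b) ^ (m - j)\<bar>) = 2 * \<epsilon>"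
      and match: "\<forall>t\<le>k. (\<Sum>z\<le>m - t. real ((m - t) choose z) * A (t + z)) = a ^ t"
      and sep: "\<forall>M. m - k \<le> M \<longrightarrow> M \<le> m \<longrightarrow> c * \<phi> \<epsilon> \<le> (1 - a) ^ M - (1 - b) ^ M"
      using elim(1) by (elim exE conjE) (rule that)
    then have hb: "hidden_block k m a b A"
      unfolding hidden_block_def by blast
    \<comment> \<open>The law of the block and \<open>B\<close> are fixed before \<open>n\<close>,
      so they are constants while \<open>n\<close> grows.\<close>
    define B where "B = hidden_block.B m a A"
    have "B \<ge> 1"
      unfolding B_def by (rule hidden_block.B_ge_1[OF hb])
    have "2 * g \<epsilon> \<le> c / 2 * \<phi> \<epsilon>"
      using elim(2,3) by simp
    also have "\<dots> < c * \<phi> \<epsilon>"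
      using c elim(3) by simp
    finally have gap: "2 * g \<epsilon> < c * \<phi> \<epsilon>" .
    have "\<forall>\<^sub>F n in sequentially. m \<le> n" "\<forall>\<^sub>F n in sequentially. 0 < n"
      by (rule eventually_ge_at_top, rule eventually_gt_at_top)
    with eventually_power_budget[OF K k(2) \<open>B \<ge> 1\<close> zero_le_power2[of "real (m choose Suc k)"]]
    show ?case
    proof eventually_elim
      case (elim n)
      show ?case
      proof (intro allI impI, elim conjE)
        fix M :: "det_sq_alg measure"
        assume M: "sq_alg n M" "learns n \<epsilon> (g \<epsilon>) M"
        show "can_happen n \<epsilon> M (makes_queries_at_least (real n powr K)) \<or>
          can_happen n \<epsilon> M (makes_query_of_tolerance_at_most (real n powr - K))"
        proof (rule hidden_block.sq_hard[OF hb TV _ elim(2) _ _ _ M])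
          show "2 * g \<epsilon> < (1 - a) ^ M - (1 - b) ^ M" if "m - k \<le> M" "M \<le> m" for M
            using gap sep that by force
        qed (use elim in \<open>simp_all add: B_def\<close>)
      qed
    qed
  qed
  then show "\<exists>\<epsilon>\<^sub>0>0. \<forall>\<epsilon>\<in>{0<..<\<epsilon>\<^sub>0}. \<forall>\<^sub>F n in sequentially. \<forall>M :: det_sq_alg measure.
      sq_alg n M \<and> learns n \<epsilon> (g \<epsilon>) M \<longrightarrow>
        can_happen n \<epsilon> M (makes_queries_at_least (real n powr K)) \<or>
        can_happen n \<epsilon> M (makes_query_of_tolerance_at_most (real n powr - K))"
    unfolding eventually_at_right_field by auto
qed

end
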